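(* Let $(r,a,\delta)\in\mathbb{N}\times\mathbb{N}_0\times\{0,1\}$ be a triple such that there exists a K3 surface with a simple non-symplectic involution with invariants $(r,a,\delta)$. Then there exists a K3 surface (with ADE-singularities) which has $3$ singular points with $A_1$-singularities and $2$ singular points with $E_8$-singularities (and no other singular points) and carries a hyper-K\"ahler metric that is invariant with respect to a non-symplectic involution with the same values of $(r,a,\delta)$.
   Context: K3 lattice and standard basis. $L = H_1\oplus H_2\oplus H_3\oplus(-E_8)_1\oplus(-E_8)_2$ is the K3 lattice, where each $H_i$ is a hyperbolic plane with basis $(u_1^i,u_2^i)$, $u_1^i\cdot u_1^i=u_2^i\cdot u_2^i=0$, $u_1^i\cdot u_2^i=1$, and each $(-E_8)_i$ is the negative definite $E_8$-lattice with a basis $(v_1^i,\ldots,v_8^i)$ of simple roots ($v_a^i\cdot v_a^i=-2$; $v_a^i\cdot v_b^i=1$ if $a,b$ are joined in the Dynkin diagram $E_8$, and $0$ otherwise for $a\neq b$). The standard basis of $L$ is $(w_1,\ldots,w_{22})=(u_1^1,u_2^1,u_1^2,u_2^2,u_1^3,u_2^3,v_1^1,\ldots,v_8^1,v_1^2,\ldots,v_8^2)$. A marking of a smooth K3 surface $S$ is a lattice isometry $\phi:H^2(S,\mathbb{Z})\rightarrow L$. Non-symplectic involutions (smooth case). A non-symplectic involution of a smooth K3 surface $S$ is a biholomorphic involution $\rho\neq\mathrm{Id}$ acting as $-1$ on $H^{2,0}(S)$. Its fixed lattice $L^\rho=\{x\in H^2(S,\mathbb{Z})\mid\rho^*x=x\}$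 is even, of signature $(1,t)$ and 2-elementary; its invariants $(r,a,\delta)$ are the rank $r$, the number $a$ with $L^{\rho\ast}/L^\rho\cong\mathbb{Z}_2^a$, and $\delta=0$ if $x^2\in\mathbb{Z}$ for all $x$ in the dual lattice $L^{\rho\ast}$, $\delta=1$ otherwise. $\rho$ is simple if there is a marking $\phi$ such that $\phi\circ\rho^*\circ\phi^{-1}$ maps each $w_i$ to some $\pm w_j$. Singular K3 surfaces. Marked K3 surfaces with at most ADE-singularities equipped with a hyper-K\"ahler structure correspond to triples $\alpha=(x,y,z)\in L_{\mathbb{R}}^3$ with $x^2=y^2=z^2>0$ and $x\cdot y=x\cdot z=y\cdot z=0$, where $z$ is the image of the K\"ahler class $[\omega_I]$ and $x,y$ are the images of the classes $[\omega_J],[\omega_K]$ of the real and imaginary part of the holomorphic $(2,0)$-form. The singular points are described by the root system $\mathcal{D}_\alpha=\{d\in L\mid d^2=-2,\ x\cdot d=y\cdot d=z\cdot d=0\}$: its Dynkin diagram is a disjoint union of simply laced connected diagrams, one for each singular point, and each gives the type of that point. A non-symplectic involution of such a (possibly singular) surface leaving the hyper-K\"ahler metric invariant, with invariants $(r,a,\delta)$, is an isometric involution, holomorphic with respect to $I$, that is induced by an involution $\rho\in\mathrm{Aut}(L)$ with $\rho(x)=-x$, $\rho(y)=-y$, $\rho(z)=z$ whose fixed lattice in $L$ is a hyperbolic 2-elementary lattice with invariants $(r,a,\delta)$. ("Induced" means that its pull-back on $H^2(S,\mathbb{R})$, identified with the orthogonal complement of $\mathcal{D}_\alpha$ in $L_{\mathbb{R}}$,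 is the restriction of $\rho$.) *)

theory Defs
  imports
    "HOL-Analysis.Analysis"
    "HOL-Algebra.Coset"
    "HOL-Algebra.Product_Groups"
    "HOL-Library.Multiset"
begin

section \<open>Simply laced Dynkin diagrams\<close>

datatype ade = A_type nat | D_type nat | E_type nat

fun ade_valid :: "ade \<Rightarrow> bool" where
  "ade_valid (A_type n) = (n \<ge> 1)"
| "ade_valid (D_type n) = (n \<ge> 4)"
| "ade_valid (E_type n) = (6 \<le> n \<and> n \<le> 8)"

fun ade_rank :: "ade \<Rightarrow> nat" where
  "ade_rank (A_type n) = n"
| "ade_rank (D_type n) = n"
| "ade_rank (E_type n) = n"

text \<open>The vertices are \<open>1, \<dots>, n\<close>; the edges follow the numbering of Bourbaki.\<close>

fun ade_edges :: "ade \<Rightarrow> nat set set" where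
  "ade_edges (A_type n) = {{k, k + 1} | k. 1 \<le> k \<and> k < n}"
| "ade_edges (D_type n) = {{k, k + 1} | k. 1 \<le> k \<and> k + 1 < n} \<union> {{n - 2, n}}"
| "ade_edges (E_type n) = {{1, 3}, {2, 4}} \<union> {{k, k + 1} | k. 3 \<le> k \<and> k < n}"


section \<open>The K3 lattice\<close>

datatype e8_node = N1 | N2 | N3 | N4 | N5 | N6 | N7 | N8

fun e8_label :: "e8_node \<Rightarrow> nat" where
  "e8_label N1 = 1" | "e8_label N2 = 2" | "e8_label N3 = 3" | "e8_label N4 = 4"
| "e8_label N5 = 5" | "e8_label N6 = 6" | "e8_label N7 = 7" | "e8_label N8 = 8"

instance e8_node :: finite
proof
  have "(UNIV :: e8_node set) = {N1, N2, N3, N4, N5, N6, N7, N8}"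
    using e8_node.exhaust by auto
  then show "finite (UNIV :: e8_node set)"
    by (metis finite.simps)
qed

text \<open>Indices of the standard basis: \<open>U1 i\<close>, \<open>U2 i\<close> stand for the two isotropic generators of
  the hyperbolic plane \<open>H\<^sub>i\<close>, and \<open>V k a\<close> for the \<open>a\<close>-th simple root of the \<open>k\<close>-th copy
  of the negative \<open>E\<^sub>8\<close>-lattice.\<close>

datatype k3_index = U1 3 | U2 3 | V 2 e8_node

instance k3_index :: finite
proof
  have "(UNIV :: k3_index set) = range U1 \<union> range U2 \<union> (\<lambda>(k, a). V k a) ` UNIV"
    by (auto simp: image_iff) (metis k3_index.exhaust)
  then show "finite (UNIV :: k3_index set)"
    by (metis finite_UnI finite_imageI finite)
qed

fun gram :: "k3_index \<Rightarrow> k3_index \<Rightarrow> int" where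
  "gram (U1 i) (U2 j) = (if i = j then 1 else 0)"
| "gram (U2 i) (U1 j) = (if i = j then 1 else 0)"
| "gram (V k a) (V l b) =
     (if k \<noteq> l then 0
      else if a = b then - 2
      else if {e8_label a, e8_label b} \<in> ade_edges (E_type 8) then 1
      else 0)"
| "gram _ _ = 0"

text \<open>The type \<open>k3\<close> is the real vector space \<open>L \<otimes> \<real>\<close>, and \<open>k3_lattice\<close> is \<open>L\<close> inside it.
  The form \<open>\<bullet>\<bullet>\<close> is the intersection form, not the Euclidean inner product.\<close>

type_synonym k3 = "real ^ k3_index"

definition k3_form :: "k3 \<Rightarrow> k3 \<Rightarrow> real" (infixl "\<bullet>\<bullet>" 70) where
  "v \<bullet>\<bullet> w = (\<Sum>i\<in>UNIV. \<Sum>j\<in>UNIV. of_int (gram i j) * v $ i * w $ j)"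

definition k3_lattice :: "k3 set" where
  "k3_lattice = {v. \<forall>i. v $ i \<in> \<int>}"

definition std_basis :: "k3_index \<Rightarrow> k3" where
  "std_basis i = axis i 1"

text \<open>An automorphism of \<open>L\<close> is represented by its unique linear extension to \<open>L \<otimes> \<real>\<close>.\<close>

definition lattice_aut :: "(k3 \<Rightarrow> k3) set" where
  "lattice_aut = {f. linear f \<and> f ` k3_lattice = k3_lattice \<and> (\<forall>v w. f v \<bullet>\<bullet> f w = v \<bullet>\<bullet> w)}"

definition lattice_involution :: "(k3 \<Rightarrow> k3) \<Rightarrow> bool" where
  "lattice_involution \<rho> \<longleftrightarrow> \<rho> \<in> lattice_aut \<and> \<rho> \<circ> \<rho> = id \<and> \<rho> \<noteq> id"

definition fixed_lattice :: "(k3 \<Rightarrow> k3) \<Rightarrow> k3 set" where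
  "fixed_lattice \<rho> = {v \<in> k3_lattice. \<rho> v = v}"


section \<open>Invariants of sublattices\<close>

text \<open>For a subgroup \<open>M\<close> of \<open>k3_lattice\<close> the real span of \<open>M\<close> is \<open>M \<otimes> \<real>\<close>, so that
  \<open>dim M\<close> is the rank of \<open>M\<close>. The dual lattice is realised inside \<open>M \<otimes> \<real>\<close>, which is the usual
  identification if the form is nondegenerate on \<open>M\<close>.\<close>

definition dual_lattice :: "k3 set \<Rightarrow> k3 set" where
  "dual_lattice M = {v \<in> span M. \<forall>w\<in>M. v \<bullet>\<bullet> w \<in> \<int>}"

definition additive_group :: "k3 set \<Rightarrow> k3 monoid" where
  "additive_group M = \<lparr>carrier = M, monoid.mult = (+), one = 0\<rparr>"

definition discriminant_group :: "k3 set \<Rightarrow> k3 set monoid" where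
  "discriminant_group M = additive_group (dual_lattice M) Mod M"

definition elementary_2_group :: "nat \<Rightarrow> (nat \<Rightarrow> int) monoid" where
  "elementary_2_group a = product_group {..<a} (\<lambda>_. integer_mod_group 2)"

definition two_elementary :: "k3 set \<Rightarrow> bool" where
  "two_elementary M \<longleftrightarrow> (\<exists>a. discriminant_group M \<cong> elementary_2_group a)"

definition delta_invariant :: "k3 set \<Rightarrow> nat" where
  "delta_invariant M = (if \<forall>v\<in>dual_lattice M. v \<bullet>\<bullet> v \<in> \<int> then 0 else 1)"

definition has_invariants :: "k3 set \<Rightarrow> nat \<Rightarrow> nat \<Rightarrow> nat \<Rightarrow> bool" where
  "has_invariants M r a \<delta> \<longleftrightarrow>
     dim M = r \<and> discriminant_group M \<cong> elementary_2_group a \<and> delta_invariant M = \<delta>"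

text \<open>The form on \<open>M \<otimes> \<real>\<close> is diagonalised by \<open>p\<close> vectors of positive and \<open>n\<close> vectors of
  negative square.\<close>

definition has_signature :: "k3 set \<Rightarrow> nat \<Rightarrow> nat \<Rightarrow> bool" where
  "has_signature M p n \<longleftrightarrow>
     (\<exists>P N. finite P \<and> finite N \<and> card P = p \<and> card N = n
        \<and> independent (P \<union> N) \<and> span (P \<union> N) = span M
        \<and> (\<forall>v\<in>P \<union> N. \<forall>w\<in>P \<union> N. v \<noteq> w \<longrightarrow> v \<bullet>\<bullet> w = 0)
        \<and> (\<forall>v\<in>P. v \<bullet>\<bullet> v > 0) \<and> (\<forall>v\<in>N. v \<bullet>\<bullet> v < 0))"

definition hyperbolic :: "k3 set \<Rightarrow> bool" where
  "hyperbolic M \<longleftrightarrow> (\<exists>t. has_signature M 1 t)"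


section \<open>Marked hyper-Kaehler K3 surfaces with ADE-singularities\<close>

text \<open>By the Torelli theorem and the surjectivity of the period map, a marked K3 surface with at
  most ADE-singularities together with a hyper-Kaehler structure is the same as a triple
  \<open>(x, y, z)\<close> as follows: \<open>z\<close> is the image of the Kaehler class of the complex structure \<open>I\<close>, and
  \<open>x\<close>, \<open>y\<close> are the images of the classes of the real and the imaginary part of the holomorphic
  2-form.\<close>

definition hk_triple :: "k3 \<Rightarrow> k3 \<Rightarrow> k3 \<Rightarrow> bool" where
  "hk_triple x y z \<longleftrightarrow>
     x \<bullet>\<bullet> x = y \<bullet>\<bullet> y \<and> y \<bullet>\<bullet> y = z \<bullet>\<bullet> z \<and> z \<bullet>\<bullet> z > 0
     \<and> x \<bullet>\<bullet> y = 0 \<and> x \<bullet>\<bullet> z = 0 \<and> y \<bullet>\<bullet> z = 0"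

definition singular_roots :: "k3 \<Rightarrow> k3 \<Rightarrow> k3 \<Rightarrow> k3 set" where
  "singular_roots x y z =
     {d \<in> k3_lattice. d \<bullet>\<bullet> d = - 2 \<and> x \<bullet>\<bullet> d = 0 \<and> y \<bullet>\<bullet> d = 0 \<and> z \<bullet>\<bullet> d = 0}"

definition simple_roots :: "k3 set \<Rightarrow> k3 set \<Rightarrow> bool" where
  "simple_roots D B \<longleftrightarrow>
     B \<subseteq> D \<and> finite B \<and> independent B
     \<and> (\<forall>d\<in>D. \<exists>c :: k3 \<Rightarrow> nat. d = (\<Sum>b\<in>B. real (c b) *\<^sub>R b) \<or> d = - (\<Sum>b\<in>B. real (c b) *\<^sub>R b))"

text \<open>For simple roots \<open>b \<noteq> b'\<close> of a root system all of whose roots have square \<open>-2\<close>, the product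
  of \<open>b\<close> and \<open>b'\<close> is \<open>0\<close> or \<open>1\<close>.\<close>

definition dynkin_edges :: "k3 set \<Rightarrow> (k3 \<times> k3) set" where
  "dynkin_edges B = {(b, b'). b \<in> B \<and> b' \<in> B \<and> b \<noteq> b' \<and> b \<bullet>\<bullet> b' = 1}"

definition dynkin_components :: "k3 set \<Rightarrow> k3 set set" where
  "dynkin_components B = B // ((dynkin_edges B)\<^sup>* \<inter> B \<times> B)"

definition has_ade_type :: "k3 set \<Rightarrow> ade \<Rightarrow> bool" where
  "has_ade_type C T \<longleftrightarrow> ade_valid T \<and>
     (\<exists>f. bij_betw f {1..ade_rank T} C \<and>
        (\<forall>i\<in>{1..ade_rank T}. \<forall>j\<in>{1..ade_rank T}.
           (f i, f j) \<in> dynkin_edges C \<longleftrightarrow> {i, j} \<in> ade_edges T))"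

text \<open>The multiset of the types of all singular points, one for each connected component of the
  Dynkin diagram of \<open>singular_roots x y z\<close>.\<close>

definition has_singularities :: "k3 \<Rightarrow> k3 \<Rightarrow> k3 \<Rightarrow> ade multiset \<Rightarrow> bool" where
  "has_singularities x y z S \<longleftrightarrow>
     (\<exists>B \<tau>. simple_roots (singular_roots x y z) B
        \<and> (\<forall>C\<in>dynkin_components B. has_ade_type C (\<tau> C))
        \<and> image_mset \<tau> (mset_set (dynkin_components B)) = S)"


section \<open>Non-symplectic involutions\<close>

definition smooth_triple :: "k3 \<Rightarrow> k3 \<Rightarrow> k3 \<Rightarrow> bool" where
  "smooth_triple x y z \<longleftrightarrow> hk_triple x y z \<and> singular_roots x y z = {}"

text \<open>The Kaehler cone of the smooth K3 surface with marking and Kaehler class given by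
  \<open>(x, y, z)\<close>: the chamber of the positive cone in \<open>H\<^sup>1\<^sup>,\<^sup>1\<close> that contains \<open>z\<close>, where the walls
  are the orthogonal complements of the \<open>(-2)\<close>-classes of type \<open>(1,1)\<close>. If \<open>z\<close> is not on a wall,
  then neither is any \<open>v\<close> below, since the last condition applies to both \<open>d\<close> and \<open>-d\<close>.\<close>

definition kaehler_cone :: "k3 \<Rightarrow> k3 \<Rightarrow> k3 \<Rightarrow> k3 set" where
  "kaehler_cone x y z =
     {v. v \<bullet>\<bullet> x = 0 \<and> v \<bullet>\<bullet> y = 0 \<and> v \<bullet>\<bullet> v > 0 \<and> v \<bullet>\<bullet> z > 0
       \<and> (\<forall>d\<in>k3_lattice. d \<bullet>\<bullet> d = - 2 \<and> x \<bullet>\<bullet> d = 0 \<and> y \<bullet>\<bullet> d = 0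
            \<longrightarrow> (v \<bullet>\<bullet> d > 0 \<longleftrightarrow> z \<bullet>\<bullet> d > 0))}"

text \<open>By the strong Torelli theorem, \<open>\<rho>\<close> is the action on the second cohomology of a (unique)
  biholomorphic map of the smooth K3 surface iff it is an isometry of \<open>L\<close> that preserves the
  line spanned by the class \<open>x + i y\<close> of the holomorphic 2-form and maps a Kaehler class to a
  Kaehler class. Non-symplectic means that the 2-form is mapped to its negative; no invariance
  of \<open>z\<close> is required.\<close>

definition nonsymplectic_involution :: "k3 \<Rightarrow> k3 \<Rightarrow> k3 \<Rightarrow> (k3 \<Rightarrow> k3) \<Rightarrow> bool" where
  "nonsymplectic_involution x y z \<rho> \<longleftrightarrow>
     smooth_triple x y z \<and> lattice_involution \<rho>
     \<and> \<rho> x = - x \<and> \<rho> y = - y \<and> \<rho> z \<in> kaehler_cone x y z"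

text \<open>A change of the marking by \<open>\<phi>\<close> conjugates \<open>\<rho>\<close> by \<open>\<phi>\<close>.\<close>

definition simple_involution :: "(k3 \<Rightarrow> k3) \<Rightarrow> bool" where
  "simple_involution \<rho> \<longleftrightarrow>
     (\<exists>\<phi>\<in>lattice_aut. \<forall>i. \<exists>j.
        (\<phi> \<circ> \<rho> \<circ> inv_into UNIV \<phi>) (std_basis i) \<in> {std_basis j, - std_basis j})"

text \<open>The (possibly singular) surface with its hyper-Kaehler metric given by \<open>(x, y, z)\<close> has an
  isometric involution induced by \<open>\<rho>\<close> that is non-symplectic with invariants \<open>(r, a, \<delta>)\<close>.\<close>

definition hk_nonsymplectic_involution ::
  "k3 \<Rightarrow> k3 \<Rightarrow> k3 \<Rightarrow> (k3 \<Rightarrow> k3) \<Rightarrow> nat \<Rightarrow> nat \<Rightarrow> nat \<Rightarrow> bool" where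
  "hk_nonsymplectic_involution x y z \<rho> r a \<delta> \<longleftrightarrow>
     hk_triple x y z \<and> lattice_involution \<rho>
     \<and> \<rho> x = - x \<and> \<rho> y = - y \<and> \<rho> z = z
     \<and> hyperbolic (fixed_lattice \<rho>) \<and> two_elementary (fixed_lattice \<rho>)
     \<and> has_invariants (fixed_lattice \<rho>) r a \<delta>"

end

theory Submission
  imports Defs
begin

text \<open>Conjugating back by the marking, a simple involution permutes the vectors \<open>u\<^sub>1\<^sup>i + u\<^sub>2\<^sup>i\<close> up to
  signs: each \<open>u\<close> is isotropic and goes to plus or minus an isotropic basis vector, and its partner
  goes along with the same sign. So \<open>\<rho>\<close> preserves their positive definite span \<open>P\<close> and its negative
  definite complement. Orthogonal projection to \<open>P\<close> commutes with \<open>\<rho>\<close> and does not decrease squares;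
  hence the projections of the old \<open>x\<close>, \<open>y\<close> and \<open>z + \<rho> z\<close> yield an orthonormal basis of \<open>P\<close> on which
  \<open>\<rho>\<close> acts as \<open>-1, -1, 1\<close>. This is the new triple, with the same \<open>\<rho>\<close>. The orthogonal complement
  of \<open>P\<close> in the lattice is spanned by the \<open>u\<^sub>1\<^sup>i - u\<^sub>2\<^sup>i\<close> and the two \<open>E\<^sub>8\<close>-bases, which form
  a diagram of type \<open>3A\<^sub>1 + 2E\<^sub>8\<close>.\<close>


section \<open>The intersection form\<close>

lemma sum_k3_index:
  fixes f :: "k3_index \<Rightarrow> 'a::comm_monoid_add"
  shows "(\<Sum>i\<in>UNIV. f i) =
    (\<Sum>i\<in>UNIV. f (U1 i)) + (\<Sum>i\<in>UNIV. f (U2 i)) + (\<Sum>k\<in>UNIV. \<Sum>a\<in>UNIV. f (V k a))"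
proof -
  have U: "(UNIV :: k3_index set) = range U1 \<union> range U2 \<union> (\<lambda>(k, a). V k a) ` UNIV"
    by (auto simp: image_iff) (metis k3_index.exhaust)
  have "(\<Sum>i\<in>UNIV. f i) = sum f (range U1) + sum f (range U2) + sum f ((\<lambda>(k, a). V k a) ` UNIV)"
    unfolding U by (subst sum.union_disjoint; (subst sum.union_disjoint)?; auto)
  also have "sum f (range U1) = (\<Sum>i\<in>UNIV. f (U1 i))"
    by (subst sum.reindex) (auto simp: inj_on_def)
  also have "sum f (range U2) = (\<Sum>i\<in>UNIV. f (U2 i))"
    by (subst sum.reindex) (auto simp: inj_on_def)
  also have "sum f ((\<lambda>(k, a). V k a) ` UNIV) = (\<Sum>k\<in>UNIV. \<Sum>a\<in>UNIV. f (V k a))"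
    by (subst sum.reindex)
      (auto simp: inj_on_def sum.cartesian_product case_prod_unfold simp flip: UNIV_Times_UNIV)
  finally show ?thesis .
qed

lemma UNIV_e8_node: "UNIV = {N1, N2, N3, N4, N5, N6, N7, N8}"
  using e8_node.exhaust by auto

lemma sum_e8_node:
  fixes f :: "e8_node \<Rightarrow> 'a::comm_monoid_add"
  shows "(\<Sum>a\<in>UNIV. f a) = f N1 + f N2 + f N3 + f N4 + f N5 + f N6 + f N7 + f N8"
  by (simp add: UNIV_e8_node add.assoc)

text \<open>An explicit list of edges lets rewriting decide adjacency of concrete nodes. The
  defining equations would turn \<open>ade_edges (E_type 8)\<close> into a set comprehension
  instead, hence \<open>del: ade_edges.simps\<close> in later proofs.\<close>

lemma ade_edges_E8:
  "ade_edges (E_type 8) = {{1, 3}, {2, 4}, {3, 4}, {4, 5}, {5, 6}, {6, 7}, {7, 8}}"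
proof -
  have "{{k, k + 1} | k::nat. 3 \<le> k \<and> k < 8} = (\<lambda>k. {k, k + 1}) ` {3..<8}"
    by auto
  also have "{3..<8::nat} = {3, 4, 5, 6, 7}" by auto
  finally show ?thesis
    by (simp add: insert_commute numeral_eq_Suc)
qed

lemma gram_commute: "gram i j = gram j i"
  by (cases i; cases j) (auto simp: insert_commute)

lemma form_commute: "v \<bullet>\<bullet> w = w \<bullet>\<bullet> v"
  unfolding k3_form_def
  by (subst sum.swap) (simp add: gram_commute mult.commute mult.left_commute)

lemma form_add_left [simp]: "(u + v) \<bullet>\<bullet> w = u \<bullet>\<bullet> w + v \<bullet>\<bullet> w"
  by (simp add: k3_form_def algebra_simps sum.distrib)

lemma form_scaleR_left [simp]: "(c *\<^sub>R v) \<bullet>\<bullet> w = c * (v \<bullet>\<bullet> w)"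
  by (simp add: k3_form_def sum_distrib_left mult_ac)

lemma form_add_right [simp]: "w \<bullet>\<bullet> (u + v) = w \<bullet>\<bullet> u + w \<bullet>\<bullet> v"
  by (simp add: form_commute [of w])

lemma form_scaleR_right [simp]: "w \<bullet>\<bullet> (c *\<^sub>R v) = c * (w \<bullet>\<bullet> v)"
  by (simp add: form_commute [of w])

lemma form_minus_left [simp]: "(- v) \<bullet>\<bullet> w = - (v \<bullet>\<bullet> w)"
  using form_scaleR_left [of "-1" v w] by simp

lemma form_minus_right [simp]: "w \<bullet>\<bullet> (- v) = - (w \<bullet>\<bullet> v)"
  by (simp add: form_commute [of w])

lemma form_diff_left [simp]: "(u - v) \<bullet>\<bullet> w = u \<bullet>\<bullet> w - v \<bullet>\<bullet> w"
  using form_add_left [of u "- v" w] by simp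

lemma form_diff_right [simp]: "w \<bullet>\<bullet> (u - v) = w \<bullet>\<bullet> u - w \<bullet>\<bullet> v"
  by (simp add: form_commute [of w])

lemma form_zero_left [simp]: "0 \<bullet>\<bullet> w = 0"
  by (simp add: k3_form_def)

lemma form_zero_right [simp]: "w \<bullet>\<bullet> 0 = 0"
  by (simp add: k3_form_def)

lemma form_sum_left: "(\<Sum>i\<in>A. f i) \<bullet>\<bullet> w = (\<Sum>i\<in>A. f i \<bullet>\<bullet> w)"
  by (induction A rule: infinite_finite_induct) auto

lemma form_sum_right: "w \<bullet>\<bullet> (\<Sum>i\<in>A. f i) = (\<Sum>i\<in>A. w \<bullet>\<bullet> f i)"
  by (simp add: form_commute [of w] form_sum_left)

lemma form_span_eq_0:
  assumes "v \<in> span A" and "\<And>w. w \<in> A \<Longrightarrow> w \<bullet>\<bullet> u = 0"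
  shows "v \<bullet>\<bullet> u = 0"
  using assms(1) by (induction rule: span_induct_alt) (auto simp: assms(2))

section \<open>Coordinate formulas for the form, evenness, and definiteness of the E8 parts\<close>

lemma sum_kronecker:
  fixes f :: "'b::finite \<Rightarrow> real"
  shows "(\<Sum>j\<in>UNIV. (if j = i then 1 else 0) * f j) = f i"
    "(\<Sum>j\<in>UNIV. (if i = j then 1 else 0) * f j) = f i"
    "(\<Sum>j\<in>UNIV. f j * (if j = i then 1 else 0)) = f i"
  by (simp_all add: if_distrib [of "\<lambda>x. x * _"] if_distrib [of "\<lambda>x. _ * x"] cong: if_cong)

lemma form_std_basis_right: "v \<bullet>\<bullet> std_basis l = (\<Sum>j\<in>UNIV. of_int (gram j l) * v $ j)"
  unfolding k3_form_def std_basis_def axis_def by (simp add: sum_kronecker)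

lemma form_std_basis: "std_basis i \<bullet>\<bullet> std_basis j = of_int (gram i j)"
  unfolding form_std_basis_right by (simp add: std_basis_def axis_def sum_kronecker)

text \<open>This is minus half the square of the vector with coordinates \<open>c\<close> in a copy
  of the negative E8-lattice: one square per node, one mixed term per edge. Halving leaves integer
  coefficients, from which evenness of the lattice is read off.\<close>

definition e8_quad :: "(e8_node \<Rightarrow> real) \<Rightarrow> real" where
  "e8_quad c = (\<Sum>a\<in>UNIV. (c a)\<^sup>2) - c N1 * c N3 - c N2 * c N4 - c N3 * c N4
     - c N4 * c N5 - c N5 * c N6 - c N6 * c N7 - c N7 * c N8"

text \<open>Completing squares along the three arms of the diagram towards the branch node \<open>N4\<close>.\<close>

lemma e8_quad_squares:
  "e8_quad c = (c N8 - c N7 / 2)\<^sup>2 + 3/4 * (c N7 - 2/3 * c N6)\<^sup>2 + 2/3 * (c N6 - 3/4 * c N5)\<^sup>2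
     + 5/8 * (c N5 - 4/5 * c N4)\<^sup>2 + (c N1 - c N3 / 2)\<^sup>2 + 3/4 * (c N3 - 2/3 * c N4)\<^sup>2
     + (c N2 - c N4 / 2)\<^sup>2 + (c N4)\<^sup>2 / 60"
  unfolding e8_quad_def sum_e8_node by (simp add: power2_eq_square field_simps)

lemma e8_quad_nonneg: "e8_quad c \<ge> 0"
  unfolding e8_quad_squares by simp

text \<open>All squares in \<open>e8_quad_squares\<close> have positive coefficients, so each of
  them vanishes. One of them is \<open>c N4\<close> itself; the others then kill the remaining
  coordinates outward along the three arms.\<close>

lemma e8_quad_eq_0D:
  assumes "e8_quad c = 0"
  shows "c a = 0"
proof -
  let ?s = "\<lambda>x::real. x\<^sup>2 = 0"
  have nn: "(x::real)\<^sup>2 \<ge> 0" for x by simp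
  have "?s (c N4)" "?s (c N2 - c N4 / 2)" "?s (c N3 - 2/3 * c N4)" "?s (c N1 - c N3 / 2)"
    "?s (c N5 - 4/5 * c N4)" "?s (c N6 - 3/4 * c N5)" "?s (c N7 - 2/3 * c N6)" "?s (c N8 - c N7 / 2)"
    using assms [unfolded e8_quad_squares] nn [of "c N4"] nn [of "c N2 - c N4 / 2"]
      nn [of "c N3 - 2/3 * c N4"] nn [of "c N1 - c N3 / 2"] nn [of "c N5 - 4/5 * c N4"]
      nn [of "c N6 - 3/4 * c N5"] nn [of "c N7 - 2/3 * c N6"] nn [of "c N8 - c N7 / 2"]
    by linarith+
  then show ?thesis by (cases a) simp_all
qed

lemma sum_gram_U:
  fixes f g :: "3 \<Rightarrow> real"
  shows "(\<Sum>i\<in>UNIV. \<Sum>j\<in>UNIV. of_int (if i = j then 1 else 0) * f i * g j) = (\<Sum>i\<in>UNIV. f i * g i)"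
proof (intro sum.cong refl)
  fix i :: 3
  have "(\<Sum>j\<in>UNIV. of_int (if i = j then 1 else 0) * f i * g j)
      = (\<Sum>j\<in>UNIV. if i = j then f i * g j else 0)"
    by (intro sum.cong refl) auto
  then show "(\<Sum>j\<in>UNIV. of_int (if i = j then 1 else 0) * f i * g j) = f i * g i"
    by simp
qed

text \<open>Different copies of E8 are orthogonal, so only \<open>l = k\<close> contributes. Each
  edge occurs in both orders, and the diagonal entries are -2, which gives the common factor
  2.\<close>

lemma sum_gram_V:
  fixes v :: k3
  shows "(\<Sum>a\<in>UNIV. \<Sum>l\<in>UNIV. \<Sum>b\<in>UNIV. of_int (gram (V k a) (V l b)) * v $ V k a * v $ V l b)
    = - 2 * e8_quad (\<lambda>a. v $ V k a)"
proof -
  have "(\<Sum>a\<in>UNIV. \<Sum>l\<in>UNIV. \<Sum>b\<in>UNIV. of_int (gram (V k a) (V l b)) * v $ V k a * v $ V l b)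
    = (\<Sum>a\<in>UNIV. \<Sum>l\<in>UNIV. if l = k then
        \<Sum>b\<in>UNIV. of_int (gram (V k a) (V l b)) * v $ V k a * v $ V l b else 0)"
    by (intro sum.cong refl) auto
  also have "\<dots> = (\<Sum>a\<in>UNIV. \<Sum>b\<in>UNIV. of_int (gram (V k a) (V k b)) * v $ V k a * v $ V k b)"
    by (simp only: sum.delta finite UNIV_I if_True)
  also have "\<dots> = - 2 * e8_quad (\<lambda>a. v $ V k a)"
    unfolding e8_quad_def
    by (simp add: sum_e8_node ade_edges_E8 doubleton_eq_iff del: ade_edges.simps)
      (simp add: power2_eq_square algebra_simps)
  finally show ?thesis .
qed

lemma form_self:
  fixes v :: k3
  shows "v \<bullet>\<bullet> v = 2 * (\<Sum>i\<in>UNIV. v $ U1 i * v $ U2 i) - 2 * (\<Sum>k\<in>UNIV. e8_quad (\<lambda>a. v $ V k a))"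
proof -
  have "v \<bullet>\<bullet> v = (\<Sum>i\<in>UNIV. v $ U1 i * v $ U2 i) + (\<Sum>i\<in>UNIV. v $ U2 i * v $ U1 i)
     + (\<Sum>k\<in>UNIV. \<Sum>a\<in>UNIV. \<Sum>l\<in>UNIV. \<Sum>b\<in>UNIV. of_int (gram (V k a) (V l b)) * v $ V k a * v $ V l b)"
    unfolding k3_form_def sum_k3_index sum.distrib
    by (simp add: sum_gram_U [simplified])
  then show ?thesis
    unfolding sum_gram_V by (simp add: sum_distrib_left mult.commute sum_negf)
qed

text \<open>By \<open>form_self\<close>, half the square is a polynomial with integer coefficients
  in the coordinates.\<close>

lemma form_self_even:
  assumes "v \<in> k3_lattice"
  obtains n :: int where "v \<bullet>\<bullet> v = 2 * of_int n"
proof -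
  have [simp]: "v $ i \<in> \<int>" for i
    using assms by (simp add: k3_lattice_def)
  have "(\<Sum>i\<in>UNIV. v $ U1 i * v $ U2 i) - (\<Sum>k\<in>UNIV. e8_quad (\<lambda>a. v $ V k a)) \<in> \<int>"
    unfolding e8_quad_def by (intro Ints_diff Ints_sum Ints_mult Ints_power) simp_all
  then obtain n where "(\<Sum>i\<in>UNIV. v $ U1 i * v $ U2 i) - (\<Sum>k\<in>UNIV. e8_quad (\<lambda>a. v $ V k a)) = of_int n"
    by (elim Ints_cases)
  then show thesis
    using that [of n] by (simp add: form_self algebra_simps)
qed

text \<open>Three pairwise orthogonal vectors of square 2. They span a positive definite space whose
  orthogonal complement is negative definite.\<close>

definition hyp_plus :: "3 \<Rightarrow> k3" where
  "hyp_plus i = std_basis (U1 i) + std_basis (U2 i)"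

lemma form_hyp_plus_right: "v \<bullet>\<bullet> hyp_plus i = v $ U1 i + v $ U2 i"
  by (simp add: hyp_plus_def form_std_basis_right sum_k3_index sum_kronecker if_distrib [of of_int]
      cong: if_cong)

text \<open>Orthogonality makes the coordinates at \<open>U1 i\<close> and \<open>U2 i\<close>
  opposite, so each hyperbolic plane contributes -2 times a square; the E8 parts are negative
  definite anyway.\<close>

lemma form_neg_of_orthogonal:
  assumes orth: "\<And>i. v \<bullet>\<bullet> hyp_plus i = 0" and "v \<noteq> 0"
  shows "v \<bullet>\<bullet> v < 0"
proof -
  have U2: "v $ U2 i = - v $ U1 i" for i
    using orth [of i] by (simp add: form_hyp_plus_right)
  have self: "v \<bullet>\<bullet> v = - 2 * ((\<Sum>i\<in>UNIV. (v $ U1 i)\<^sup>2) + (\<Sum>k\<in>UNIV. e8_quad (\<lambda>a. v $ V k a)))"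
    by (simp add: form_self U2 sum_negf power2_eq_square algebra_simps)
  have nn: "(\<Sum>i\<in>UNIV. (v $ U1 i)\<^sup>2) \<ge> 0" "(\<Sum>k\<in>UNIV. e8_quad (\<lambda>a. v $ V k a)) \<ge> 0"
    by (auto intro!: sum_nonneg e8_quad_nonneg)
  have False if "\<not> v \<bullet>\<bullet> v < 0"
  proof -
    have "(\<Sum>i\<in>UNIV. (v $ U1 i)\<^sup>2) = 0" "(\<Sum>k\<in>UNIV. e8_quad (\<lambda>a. v $ V k a)) = 0"
      using that nn unfolding self by (smt (verit))+
    then have 1: "v $ U1 i = 0" and "e8_quad (\<lambda>a. v $ V k a) = 0" for i k
      by (simp_all add: sum_nonneg_eq_0_iff e8_quad_nonneg)
    then have "v $ V k a = 0" for k a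
      using e8_quad_eq_0D by blast
    with 1 U2 have "v $ j = 0" for j
      by (cases j) auto
    then show False
      using \<open>v \<noteq> 0\<close> by (simp add: vec_eq_iff)
  qed
  then show ?thesis by blast
qed


section \<open>Roots orthogonal to the three positive vectors\<close>

text \<open>The difference of the two isotropic generators of a plane is indexed by
  \<open>U1 i\<close>. Thus \<open>perp_index\<close> numbers a basis of the complement of all
  \<open>hyp_plus i\<close>, and the coefficient of \<open>perp_root j\<close> in a combination is
  simply its coordinate at \<open>j\<close>.\<close>

definition perp_root :: "k3_index \<Rightarrow> k3" where
  "perp_root j = (case j of U1 i \<Rightarrow> std_basis (U1 i) - std_basis (U2 i) | _ \<Rightarrow> std_basis j)"

definition perp_index :: "k3_index set" where
  "perp_index = - range U2"

lemma perp_index_cases [consumes 1, case_names U1 V]: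
  assumes "j \<in> perp_index"
  obtains i where "j = U1 i" | k a where "j = V k a"
  using assms unfolding perp_index_def by (cases j) auto

lemma mem_perp_index [simp]: "U1 i \<in> perp_index" "V k a \<in> perp_index" "U2 i \<notin> perp_index"
  by (auto simp: perp_index_def)

lemma form_perp_root:
  "perp_root (U1 i) \<bullet>\<bullet> perp_root (U1 j) = (if i = j then - 2 else 0)"
  "perp_root (U1 i) \<bullet>\<bullet> perp_root (V k a) = 0"
  "perp_root (V k a) \<bullet>\<bullet> perp_root (U1 i) = 0"
  "perp_root (V k a) \<bullet>\<bullet> perp_root (V l b) = of_int (gram (V k a) (V l b))"
  by (simp_all add: perp_root_def form_std_basis)

lemma form_perp_root_nonneg:
  assumes "i \<in> perp_index" "j \<in> perp_index" "i \<noteq> j"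
  shows "perp_root i \<bullet>\<bullet> perp_root j \<ge> 0"
  using assms by (elim perp_index_cases) (auto simp: form_perp_root simp del: ade_edges.simps)

lemma form_perp_root_self:
  assumes "i \<in> perp_index"
  shows "perp_root i \<bullet>\<bullet> perp_root i = - 2"
  using assms by (elim perp_index_cases) (auto simp: form_perp_root simp del: ade_edges.simps)

lemma perp_root_hyp_plus:
  assumes "i \<in> perp_index"
  shows "perp_root i \<bullet>\<bullet> hyp_plus j = 0"
  using assms
  by (elim perp_index_cases) (auto simp: perp_root_def hyp_plus_def form_std_basis)

lemma perp_root_lattice: "perp_root i \<in> k3_lattice"
  by (auto simp: perp_root_def k3_lattice_def std_basis_def axis_def split: k3_index.split)

lemma sum_perp_root_nth:
  assumes "j \<in> perp_index"
  shows "(\<Sum>i\<in>perp_index. c i *\<^sub>R perp_root i) $ j = c j"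
proof -
  have "(\<Sum>i\<in>perp_index. c i *\<^sub>R perp_root i) $ j = (\<Sum>i\<in>perp_index. if i = j then c i else 0)"
    unfolding sum_component
    by (intro sum.cong refl)
      (use assms in \<open>auto simp: perp_root_def std_basis_def axis_def elim!: perp_index_cases split: if_splits\<close>)
  then show ?thesis
    using assms by simp
qed

text \<open>The coordinates in \<open>perp_index\<close> agree by \<open>sum_perp_root_nth\<close>.
  The one at \<open>U2 i\<close> is determined by orthogonality to \<open>hyp_plus i\<close>, which
  both sides satisfy.\<close>

lemma perp_root_eq_sum:
  assumes "\<And>i. v \<bullet>\<bullet> hyp_plus i = 0"
  shows "v = (\<Sum>j\<in>perp_index. (v $ j) *\<^sub>R perp_root j)" (is "v = ?s")
proof -
  have s: "?s \<bullet>\<bullet> hyp_plus i = 0" for i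
    by (simp add: form_sum_left perp_root_hyp_plus)
  have "v $ j = ?s $ j" for j
  proof (cases "j \<in> perp_index")
    case False
    then obtain i where j: "j = U2 i" by (auto simp: perp_index_def)
    have "v $ U1 i = ?s $ U1 i"
      by (rule sum_perp_root_nth [symmetric]) simp
    then show ?thesis
      using assms [of i] s [of i] unfolding j form_hyp_plus_right by linarith
  qed (simp only: sum_perp_root_nth)
  then show ?thesis unfolding vec_eq_iff by blast
qed

text \<open>Distinct indices give a nonnegative product, whereas equal vectors would give
  -2.\<close>

lemma inj_on_perp_root: "inj_on perp_root perp_index"
proof (rule inj_onI, rule ccontr)
  fix i j assume ij: "i \<in> perp_index" "j \<in> perp_index" "perp_root i = perp_root j" "i \<noteq> j"
  then show False
    using form_perp_root_nonneg [of i j] form_perp_root_self [of j] by simp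
qed

lemma independent_perp_root: "independent (perp_root ` perp_index)"
proof (rule independent_if_scalars_zero)
  fix f :: "k3 \<Rightarrow> real" and x
  assume 0: "(\<Sum>x\<in>perp_root ` perp_index. f x *\<^sub>R x) = 0" and "x \<in> perp_root ` perp_index"
  then obtain j where j: "j \<in> perp_index" "x = perp_root j" by auto
  have "(\<Sum>i\<in>perp_index. f (perp_root i) *\<^sub>R perp_root i) = 0"
    using 0 by (simp add: sum.reindex inj_on_perp_root)
  then show "f x = 0"
    using sum_perp_root_nth [OF j(1), of "\<lambda>i. f (perp_root i)"] j(2) by simp
qed simp

text \<open>Split \<open>d = u - w\<close> into the parts with positive and negative coefficients. Their product is
  nonnegative because distinct \<open>perp_root\<close>s have nonnegative products, so if both were nonzero
  then \<open>d\<close> would have square at most \<open>-4\<close>, as the lattice is even.\<close>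

lemma root_combination:
  assumes d: "d \<in> k3_lattice" "d \<bullet>\<bullet> d = - 2" and orth: "\<And>i. d \<bullet>\<bullet> hyp_plus i = 0"
  obtains c :: "k3_index \<Rightarrow> nat" where
    "d = (\<Sum>j\<in>perp_index. real (c j) *\<^sub>R perp_root j)
      \<or> d = - (\<Sum>j\<in>perp_index. real (c j) *\<^sub>R perp_root j)"
proof -
  define comb where "comb c = (\<Sum>j\<in>perp_index. real (c j) *\<^sub>R perp_root j)" for c :: "k3_index \<Rightarrow> nat"
  have comb_lattice: "comb c \<in> k3_lattice" for c
    using perp_root_lattice unfolding comb_def k3_lattice_def sum_component
    by (auto intro!: Ints_sum)
  have comb_orth: "comb c \<bullet>\<bullet> hyp_plus i = 0" for c i
    unfolding comb_def by (simp add: form_sum_left perp_root_hyp_plus)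
  have le: "comb c \<bullet>\<bullet> comb c \<le> - 2" if "comb c \<noteq> 0" for c
  proof -
    have "comb c \<bullet>\<bullet> comb c < 0"
      using form_neg_of_orthogonal comb_orth that by blast
    moreover obtain n :: int where "comb c \<bullet>\<bullet> comb c = 2 * of_int n"
      using form_self_even comb_lattice by blast
    ultimately show ?thesis by simp
  qed
  define z where "z j = \<lfloor>d $ j\<rfloor>" for j
  have z: "d $ j = of_int (z j)" for j
    using d(1) by (auto simp: k3_lattice_def z_def)
  \<comment> \<open>\<open>nat\<close> truncates negative integers to 0, so \<open>p\<close> and
    \<open>m\<close> are the positive and the negative part of the coordinates and have disjoint
    supports.\<close>
  define p where "p j = nat (z j)" for j
  define m where "m j = nat (- z j)" for j
  have pm: "d $ j = real (p j) - real (m j)" for j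
    unfolding z p_def m_def by (cases "z j \<ge> 0") simp_all
  have "d = comb p - comb m"
    using perp_root_eq_sum [OF orth] unfolding comb_def
    by (simp add: pm algebra_simps flip: sum_subtractf)
  moreover have "comb p \<bullet>\<bullet> comb m \<ge> 0"
    unfolding comb_def form_sum_left form_sum_right
  proof (intro sum_nonneg)
    fix i j assume ij: "i \<in> perp_index" "j \<in> perp_index"
    show "(real (p i) *\<^sub>R perp_root i) \<bullet>\<bullet> (real (m j) *\<^sub>R perp_root j) \<ge> 0"
    proof (cases "i = j")
      \<comment> \<open>On the diagonal the product of the roots is -2, but there \<open>p j\<close>
        or \<open>m j\<close> is 0.\<close>
      case True
      then show ?thesis by (cases "z j \<ge> 0") (simp_all add: p_def m_def)
    qed (simp add: form_perp_root_nonneg ij)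
  qed
  ultimately have "comb p \<bullet>\<bullet> comb p + comb m \<bullet>\<bullet> comb m \<ge> - 2"
    using d(2) form_commute [of "comb m" "comb p"] by simp
  then have "comb p = 0 \<or> comb m = 0"
    using le [of p] le [of m] by fastforce
  then show thesis
    using that [of p] that [of m] \<open>d = comb p - comb m\<close> by (auto simp: comb_def)
qed

lemma bij_e8_label: "bij_betw e8_label UNIV {1..8}"
proof (rule bij_betwI')
  fix x y show "e8_label x = e8_label y \<longleftrightarrow> x = y"
    by (cases x; cases y) simp_all
next
  fix x show "e8_label x \<in> {1..8}"
    by (cases x) simp_all
next
  fix n :: nat assume "n \<in> {1..8}"
  then have "n = 1 \<or> n = 2 \<or> n = 3 \<or> n = 4 \<or> n = 5 \<or> n = 6 \<or> n = 7 \<or> n = 8" by auto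
  then show "\<exists>x\<in>UNIV. n = e8_label x"
    using e8_label.simps by (metis UNIV_I)
qed

lemma has_ade_type_A1: "has_ade_type {c} (A_type 1)"
proof -
  have "bij_betw (\<lambda>_. c) {1..ade_rank (A_type 1)} {c}"
    by (simp add: bij_betw_def)
  moreover have "ade_edges (A_type 1) = {}" "dynkin_edges {c} = {}"
    by (auto simp: dynkin_edges_def)
  ultimately show ?thesis
    unfolding has_ade_type_def by (intro conjI exI [of _ "\<lambda>_. c"]) simp_all
qed

section \<open>Automorphisms and the Dynkin diagram\<close>

text \<open>For bijectivity, the image contains the lattice, hence the standard basis, hence
  everything, and a surjective endomorphism of a finite-dimensional space is injective. Injectivity
  in turn yields the equivalence for lattice membership.\<close>

lemma lattice_autD:
  assumes "f \<in> lattice_aut"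
  shows "linear f" "f v \<bullet>\<bullet> f w = v \<bullet>\<bullet> w" "f v \<in> k3_lattice \<longleftrightarrow> v \<in> k3_lattice" "bij f"
proof -
  show lin: "linear f" and "f v \<bullet>\<bullet> f w = v \<bullet>\<bullet> w"
    using assms by (auto simp: lattice_aut_def)
  have im: "f ` k3_lattice = k3_lattice"
    using assms by (simp add: lattice_aut_def)
  have "std_basis i \<in> k3_lattice" for i
    by (simp add: std_basis_def k3_lattice_def axis_def)
  then have "std_basis i \<in> range f" for i
    using im by blast
  moreover have "subspace (range f)"
    using lin by (simp add: linear_subspace_image)
  ultimately have "(\<Sum>i\<in>UNIV. v $ i *\<^sub>R std_basis i) \<in> range f" for v
    by (intro subspace_sum subspace_scale)
  then have "v \<in> range f" for v
    using basis_expansion [of v] unfolding std_basis_def scalar_mult_eq_scaleR by metis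
  then have surj: "surj f" by blast
  then have inj: "inj f"
    using lin linear_surjective_imp_injective by blast
  with surj show "bij f" by (simp add: bij_def)
  show "f v \<in> k3_lattice \<longleftrightarrow> v \<in> k3_lattice"
    using im inj by (metis inj_image_mem_iff)
qed

lemma lattice_aut_inv:
  assumes "f \<in> lattice_aut"
  shows "inv_into UNIV f \<in> lattice_aut"
proof -
  note f = lattice_autD [OF assms]
  have [simp]: "f (inv_into UNIV f v) = v" for v
    using f(4) by (simp add: bij_is_surj surj_f_inv_f)
  have "linear (inv_into UNIV f)"
    using f(1,4) by (simp add: bij_is_inj bij_is_surj inj_linear_imp_inv_linear)
  moreover have "inv_into UNIV f ` k3_lattice = k3_lattice"
  proof
    show "inv_into UNIV f ` k3_lattice \<subseteq> k3_lattice"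
      using f(3) [of "inv_into UNIV f v" for v] by auto
    show "k3_lattice \<subseteq> inv_into UNIV f ` k3_lattice"
      using f(3,4) by (metis bij_is_inj image_eqI inv_f_f subsetI)
  qed
  moreover have "inv_into UNIV f v \<bullet>\<bullet> inv_into UNIV f w = v \<bullet>\<bullet> w" for v w
    using f(2) [of "inv_into UNIV f v" "inv_into UNIV f w"] by simp
  ultimately show ?thesis by (simp add: lattice_aut_def)
qed

text \<open>The roots are transported by \<open>\<psi>\<close>, later the inverse of the marking, so
  that \<open>\<rho>\<close> itself need not be replaced by a conjugate.\<close>

definition marked_roots :: "(k3 \<Rightarrow> k3) \<Rightarrow> k3 set" where
  "marked_roots \<psi> = (\<lambda>j. \<psi> (perp_root j)) ` perp_index"

definition A1_component :: "(k3 \<Rightarrow> k3) \<Rightarrow> 3 \<Rightarrow> k3 set" where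
  "A1_component \<psi> i = {\<psi> (perp_root (U1 i))}"

definition E8_component :: "(k3 \<Rightarrow> k3) \<Rightarrow> 2 \<Rightarrow> k3 set" where
  "E8_component \<psi> k = (\<lambda>a. \<psi> (perp_root (V k a))) ` UNIV"

context
  fixes \<psi> :: "k3 \<Rightarrow> k3"
  assumes \<psi>: "\<psi> \<in> lattice_aut"
begin

lemma marked_root_eq_iff:
  assumes "i \<in> perp_index" "j \<in> perp_index"
  shows "\<psi> (perp_root i) = \<psi> (perp_root j) \<longleftrightarrow> i = j"
  using assms lattice_autD(4) [OF \<psi>]
  by (simp add: bij_def inj_eq inj_on_eq_iff [OF inj_on_perp_root])

lemma dynkin_edges_marked_roots:
  assumes "i \<in> perp_index" "j \<in> perp_index"
  shows "(\<psi> (perp_root i), \<psi> (perp_root j)) \<in> dynkin_edges (marked_roots \<psi>)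
    \<longleftrightarrow> (\<exists>k a b. i = V k a \<and> j = V k b \<and> {e8_label a, e8_label b} \<in> ade_edges (E_type 8))"
proof -
  have "(\<psi> (perp_root i), \<psi> (perp_root j)) \<in> dynkin_edges (marked_roots \<psi>)
      \<longleftrightarrow> i \<noteq> j \<and> perp_root i \<bullet>\<bullet> perp_root j = 1"
    using assms
    by (auto simp: dynkin_edges_def marked_roots_def marked_root_eq_iff lattice_autD(2) [OF \<psi>])
  \<comment> \<open>For equal nodes the pair of labels collapses to a singleton. As this is no edge,
    the right-hand side already excludes \<open>i = j\<close>.\<close>
  moreover have "{n} \<notin> ade_edges (E_type 8)" for n
    by (simp add: ade_edges_E8 singleton_insert_inj_eq del: ade_edges.simps)
  ultimately show ?thesis
    using assms by (elim perp_index_cases) (auto simp: form_perp_root simp del: ade_edges.simps)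
qed

text \<open>No edge meets a root \<open>perp_root (U1 i)\<close>, so its class is a singleton. No
  edge leaves a copy of E8, and each of its nodes is connected to the branch node \<open>N4\<close>,
  so the copy is one class.\<close>

lemma dynkin_components_marked_roots:
  "dynkin_components (marked_roots \<psi>) = range (A1_component \<psi>) \<union> range (E8_component \<psi>)"
proof -
  let ?B = "marked_roots \<psi>"
  let ?b = "\<lambda>j. \<psi> (perp_root j)"
  let ?R = "(dynkin_edges ?B)\<^sup>* \<inter> ?B \<times> ?B"
  have B: "?b j \<in> ?B" if "j \<in> perp_index" for j
    using that by (simp add: marked_roots_def)
  have A1: "?R `` {?b (U1 i)} = A1_component \<psi> i" for i
  proof -
    have "y = ?b (U1 i)" if "(?b (U1 i), y) \<in> (dynkin_edges ?B)\<^sup>*" for y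
      using that
    proof induction
      case (step y z)
      then obtain j where "z = ?b j" "j \<in> perp_index"
        by (auto simp: dynkin_edges_def marked_roots_def)
      with step show ?case
        by (simp add: dynkin_edges_marked_roots del: ade_edges.simps)
    qed simp
    then show ?thesis
      using B by (auto simp: A1_component_def)
  qed
  have E8: "?R `` {?b (V k a)} = E8_component \<psi> k" for k a
  proof -
    have "y \<in> E8_component \<psi> k" if "(?b (V k a), y) \<in> (dynkin_edges ?B)\<^sup>*" for y
      using that
    proof induction
      case base
      then show ?case by (simp add: E8_component_def)
    next
      case (step y z)
      then obtain j where j: "z = ?b j" "j \<in> perp_index"
        by (auto simp: dynkin_edges_def marked_roots_def)
      obtain b where "y = ?b (V k b)"
        using step.IH by (auto simp: E8_component_def)
      with step j show ?case
        by (auto simp: dynkin_edges_marked_roots E8_component_def simp del: ade_edges.simps)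
    qed
    moreover have "(?b (V k c), ?b (V k d)) \<in> (dynkin_edges ?B)\<^sup>*" for c d
    proof -
      have edge: "(?b (V k c), ?b (V k d)) \<in> (dynkin_edges ?B)\<^sup>*"
        if "{e8_label c, e8_label d} \<in> ade_edges (E_type 8)" for c d
        using that by (intro r_into_rtrancl) (simp add: dynkin_edges_marked_roots del: ade_edges.simps)
      have arm: "(?b (V k c), ?b (V k N4)) \<in> (dynkin_edges ?B)\<^sup>*" for c
      proof -
        have e: "(?b (V k N1), ?b (V k N3)) \<in> (dynkin_edges ?B)\<^sup>*"
          "(?b (V k N2), ?b (V k N4)) \<in> (dynkin_edges ?B)\<^sup>*"
          "(?b (V k N3), ?b (V k N4)) \<in> (dynkin_edges ?B)\<^sup>*"
          "(?b (V k N5), ?b (V k N4)) \<in> (dynkin_edges ?B)\<^sup>*"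
          "(?b (V k N6), ?b (V k N5)) \<in> (dynkin_edges ?B)\<^sup>*"
          "(?b (V k N7), ?b (V k N6)) \<in> (dynkin_edges ?B)\<^sup>*"
          "(?b (V k N8), ?b (V k N7)) \<in> (dynkin_edges ?B)\<^sup>*"
          by (intro edge; simp add: ade_edges_E8 insert_commute del: ade_edges.simps)+
        show ?thesis
          using e by (cases c) (blast intro: rtrancl_trans)+
      qed
      \<comment> \<open>Symmetry allows the path from \<open>d\<close> to \<open>N4\<close> to be
        reversed.\<close>
      have "sym ((dynkin_edges ?B)\<^sup>*)"
        by (intro sym_rtrancl symI) (auto simp: dynkin_edges_def form_commute)
      then show ?thesis
        using arm [of c] arm [of d] by (meson rtrancl_trans symD)
    qed
    ultimately show ?thesis
      using B by (auto simp: E8_component_def)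
  qed
  have "dynkin_components ?B = (\<lambda>j. ?R `` {?b j}) ` perp_index"
    by (auto simp: dynkin_components_def quotient_def marked_roots_def)
  also have "perp_index = range U1 \<union> (\<lambda>(k, a). V k a) ` UNIV"
    by (auto elim!: perp_index_cases)
  also have "(\<lambda>j. ?R `` {?b j}) ` \<dots> = range (A1_component \<psi>) \<union> (\<lambda>(k, a). E8_component \<psi> k) ` (UNIV :: (2 \<times> e8_node) set)"
    unfolding image_Un image_image by (simp add: A1 E8 case_prod_unfold)
  also have "(\<lambda>(k, a). E8_component \<psi> k) ` (UNIV :: (2 \<times> e8_node) set) = range (E8_component \<psi>)"
    by (auto simp: image_iff)
  finally show ?thesis .
qed

text \<open>The numbering of the vertices is the inverse of \<open>e8_label\<close>, since the Gram
  matrix is defined by the edges of \<open>E_type 8\<close> through these labels.\<close>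

lemma has_ade_type_E8: "has_ade_type (E8_component \<psi> k) (E_type 8)"
proof -
  define node where "node = inv_into UNIV e8_label"
  have node: "bij_betw node {1..8} UNIV"
    unfolding node_def using bij_e8_label by (rule bij_betw_inv_into)
  have label: "e8_label (node n) = n" if "n \<in> {1..8}" for n
    using that bij_e8_label unfolding node_def by (simp add: bij_betw_def f_inv_into_f)
  let ?b = "\<lambda>a. \<psi> (perp_root (V k a))"
  have "bij_betw (\<lambda>n. ?b (node n)) {1..8} (E8_component \<psi> k)"
    using bij_betw_trans [OF node, of ?b "E8_component \<psi> k"]
    by (simp add: bij_betw_def inj_on_def E8_component_def marked_root_eq_iff comp_def)
  moreover have "(?b a, ?b b) \<in> dynkin_edges (E8_component \<psi> k)
      \<longleftrightarrow> {e8_label a, e8_label b} \<in> ade_edges (E_type 8)" for a b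
  proof -
    have "(?b a, ?b b) \<in> dynkin_edges (E8_component \<psi> k)
        \<longleftrightarrow> (?b a, ?b b) \<in> dynkin_edges (marked_roots \<psi>)"
      by (auto simp: dynkin_edges_def E8_component_def marked_roots_def)
    then show ?thesis
      by (simp add: dynkin_edges_marked_roots del: ade_edges.simps)
  qed
  ultimately show ?thesis
    unfolding has_ade_type_def using label
    by (intro conjI exI [of _ "\<lambda>n. ?b (node n)"]) (simp_all del: ade_edges.simps)
qed

text \<open>Independence passes through the injective map \<open>\<psi>\<close>. A root in
  \<open>D\<close> is pulled back along \<open>\<psi>\<close>, where \<open>root_combination\<close>
  applies.\<close>

lemma simple_roots_marked_roots:
  assumes D: "\<And>d. d \<in> D \<longleftrightarrow> d \<in> k3_lattice \<and> d \<bullet>\<bullet> d = - 2 \<and> (\<forall>i. d \<bullet>\<bullet> \<psi> (hyp_plus i) = 0)"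
  shows "simple_roots D (marked_roots \<psi>)"
proof -
  note psi = lattice_autD [OF \<psi>]
  have inj: "inj_on (\<lambda>j. \<psi> (perp_root j)) perp_index"
    by (rule inj_onI) (simp add: marked_root_eq_iff)
  have "independent (\<psi> ` perp_root ` perp_index)"
    by (intro linear_independent_injective_image psi independent_perp_root)
      (use psi(4) in \<open>auto simp: bij_def intro: inj_on_subset\<close>)
  moreover have "\<exists>c :: k3 \<Rightarrow> nat. d = (\<Sum>b\<in>marked_roots \<psi>. real (c b) *\<^sub>R b)
      \<or> d = - (\<Sum>b\<in>marked_roots \<psi>. real (c b) *\<^sub>R b)" if "d \<in> D" for d
  proof -
    define e where "e = inv_into UNIV \<psi> d"
    have d: "d = \<psi> e"
      unfolding e_def using psi(4) by (simp add: bij_is_surj surj_f_inv_f)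
    then have "e \<in> k3_lattice" "e \<bullet>\<bullet> e = - 2" "\<And>i. e \<bullet>\<bullet> hyp_plus i = 0"
      using that by (auto simp: D psi(2,3))
    then obtain c :: "k3_index \<Rightarrow> nat" where c: "e = (\<Sum>j\<in>perp_index. real (c j) *\<^sub>R perp_root j)
        \<or> e = - (\<Sum>j\<in>perp_index. real (c j) *\<^sub>R perp_root j)"
      by (rule root_combination)
    have "\<psi> (\<Sum>j\<in>perp_index. real (c j) *\<^sub>R perp_root j)
        = (\<Sum>j\<in>perp_index. real (c j) *\<^sub>R \<psi> (perp_root j))"
      using psi(1) by (simp add: linear_sum linear_scale)
    \<comment> \<open>\<open>simple_roots\<close> asks for coefficients indexed by vectors;
      injectivity carries \<open>c\<close> over from the indices.\<close>
    also have "\<dots> = (\<Sum>b\<in>marked_roots \<psi>.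
        real (c (inv_into perp_index (\<lambda>j. \<psi> (perp_root j)) b)) *\<^sub>R b)"
      unfolding marked_roots_def by (simp add: sum.reindex [OF inj] inv_into_f_f [OF inj])
    finally show ?thesis
      using c d linear_neg [OF psi(1)]
      by (intro exI [of _ "\<lambda>b. c (inv_into perp_index (\<lambda>j. \<psi> (perp_root j)) b)"]) auto
  qed
  ultimately show ?thesis
    unfolding simple_roots_def
    by (auto simp: marked_roots_def image_image D psi perp_root_lattice form_perp_root_self perp_root_hyp_plus)
qed

lemma has_singularities_3A1_2E8:
  assumes "\<And>d. x \<bullet>\<bullet> d = 0 \<and> y \<bullet>\<bullet> d = 0 \<and> z \<bullet>\<bullet> d = 0 \<longleftrightarrow> (\<forall>i. d \<bullet>\<bullet> \<psi> (hyp_plus i) = 0)"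
  shows "has_singularities x y z {#A_type 1, A_type 1, A_type 1, E_type 8, E_type 8#}"
proof -
  let ?A = "A1_component \<psi>" and ?E = "E8_component \<psi>"
  define \<tau> where "\<tau> C = (if C \<in> range ?A then A_type 1 else E_type 8)" for C
  \<comment> \<open>The components form a set, so all five must be shown distinct for each to count
    in the multiset. The root at node \<open>N1\<close> serves to tell them apart.\<close>
  have AA: "?A i = ?A j \<longleftrightarrow> i = j" for i j
    by (simp add: A1_component_def marked_root_eq_iff)
  have mem: "\<psi> (perp_root (V k N1)) \<in> ?E l \<longleftrightarrow> k = l" for k l
    by (auto simp: E8_component_def marked_root_eq_iff)
  then have EE: "?E k = ?E l \<longleftrightarrow> k = l" for k l
    by metis
  have "\<psi> (perp_root (V k N1)) \<notin> ?A i" for i k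
    by (simp add: A1_component_def marked_root_eq_iff)
  then have AE: "?A i \<noteq> ?E k" for i k
    using mem by metis
  have comps: "dynkin_components (marked_roots \<psi>) = {?A 1, ?A 2, ?A 3, ?E 1, ?E 2}"
    by (auto simp: dynkin_components_marked_roots UNIV_3 UNIV_2)
  have "simple_roots (singular_roots x y z) (marked_roots \<psi>)"
    by (rule simple_roots_marked_roots) (use assms in \<open>auto simp: singular_roots_def\<close>)
  moreover have \<tau>: "\<tau> (?A i) = A_type 1" "\<tau> (?E k) = E_type 8" for i k
    using AE by (auto simp: \<tau>_def)
  then have "\<forall>C\<in>dynkin_components (marked_roots \<psi>). has_ade_type C (\<tau> C)"
    using has_ade_type_E8 has_ade_type_A1
    by (auto simp: dynkin_components_marked_roots A1_component_def)
  moreover have "image_mset \<tau> (mset_set (dynkin_components (marked_roots \<psi>)))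
      = {#A_type 1, A_type 1, A_type 1, E_type 8, E_type 8#}"
    unfolding comps using \<tau> by (simp add: AA EE AE)
  ultimately show ?thesis
    unfolding has_singularities_def by blast
qed

end


section \<open>Orthogonal bases and the fixed lattice\<close>

text \<open>Pair a vanishing combination with one of the vectors. The form is indefinite, so nonzero
  squares are assumed rather than nonzero vectors.\<close>

lemma independent_form_orthogonal:
  assumes "finite A" and orth: "\<And>v w. v \<in> A \<Longrightarrow> w \<in> A \<Longrightarrow> v \<noteq> w \<Longrightarrow> v \<bullet>\<bullet> w = 0"
    and "\<And>v. v \<in> A \<Longrightarrow> v \<bullet>\<bullet> v \<noteq> 0"
  shows "independent A"
proof (rule independent_if_scalars_zero)
  fix f v
  assume 0: "(\<Sum>w\<in>A. f w *\<^sub>R w) = 0" and v: "v \<in> A"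
  have "0 = (\<Sum>w\<in>A. f w *\<^sub>R w) \<bullet>\<bullet> v"
    by (simp add: 0)
  also have "\<dots> = (\<Sum>w\<in>A. if w = v then f w * (w \<bullet>\<bullet> v) else 0)"
    unfolding form_sum_left by (intro sum.cong refl) (use orth v in auto)
  also have "\<dots> = f v * (v \<bullet>\<bullet> v)"
    using assms(1) v by simp
  finally show "f v = 0"
    using assms(3) [OF v] by simp
qed fact

text \<open>Gram-Schmidt by induction on the dimension: split off a nonzero \<open>v\<close>. Its
  complement \<open>T\<close> inside \<open>S\<close> is smaller because \<open>v\<close> has
  nonzero square and so is not in \<open>T\<close>.\<close>

lemma negative_orthogonal_basis:
  assumes "subspace S" and "\<And>v. v \<in> S \<Longrightarrow> v \<noteq> 0 \<Longrightarrow> v \<bullet>\<bullet> v < 0"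
  obtains N where "finite N" "N \<subseteq> S" "span N = S" "\<And>v. v \<in> N \<Longrightarrow> v \<bullet>\<bullet> v < 0"
    "\<And>v w. v \<in> N \<Longrightarrow> w \<in> N \<Longrightarrow> v \<noteq> w \<Longrightarrow> v \<bullet>\<bullet> w = 0"
proof -
  have "\<exists>N. finite N \<and> N \<subseteq> S \<and> span N = S \<and> (\<forall>v\<in>N. v \<bullet>\<bullet> v < 0) \<and>
      (\<forall>v\<in>N. \<forall>w\<in>N. v \<noteq> w \<longrightarrow> v \<bullet>\<bullet> w = 0)"
    using assms
  proof (induction "dim S" arbitrary: S rule: less_induct)
    case less
    show ?case
    proof (cases "S = {0}")
      case True
      then show ?thesis by (intro exI [of _ "{}"]) simp
    next
      case False
      then obtain v where v: "v \<in> S" "v \<noteq> 0"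
        using less.prems(1) subspace_0 by blast
      then have neg: "v \<bullet>\<bullet> v < 0"
        using less.prems(2) by blast
      define T where "T = {w \<in> S. w \<bullet>\<bullet> v = 0}"
      have T: "subspace T"
        using less.prems(1) by (auto simp: T_def subspace_def)
      have "T \<subseteq> S" "v \<notin> T"
        using neg by (auto simp: T_def)
      then have "T \<subset> S"
        using v(1) by blast
      then have "dim T < dim S"
        using less.prems(1) T by (metis dim_psubset span_eq_iff)
      then obtain N where N: "finite N" "N \<subseteq> T" "span N = T" "\<forall>v\<in>N. v \<bullet>\<bullet> v < 0"
          "\<forall>v\<in>N. \<forall>w\<in>N. v \<noteq> w \<longrightarrow> v \<bullet>\<bullet> w = 0"
        using less.hyps [of T] T less.prems(2) by (auto simp: T_def)
      have "S \<subseteq> span (insert v N)"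
      proof
        fix w assume w: "w \<in> S"
        let ?c = "(w \<bullet>\<bullet> v) / (v \<bullet>\<bullet> v)"
        have "w - ?c *\<^sub>R v \<in> T"
          using w v neg less.prems(1) by (simp add: T_def subspace_diff subspace_scale)
        then show "w \<in> span (insert v N)"
          unfolding span_insert using N(3) by auto
      qed
      moreover have "insert v N \<subseteq> S"
        using v N(2) by (auto simp: T_def)
      ultimately have "span (insert v N) = S"
        using less.prems(1) by (intro span_subspace)
      moreover have "w \<bullet>\<bullet> v = 0" "v \<bullet>\<bullet> w = 0" if "w \<in> N" for w
        using that N(2) form_commute [of v w] by (auto simp: T_def)
      ultimately show ?thesis
        using \<open>insert v N \<subseteq> S\<close> N(1,4,5) neg
        by (intro exI [of _ "insert v N"] conjI ballI impI) (auto simp only: insert_iff finite_insert)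
    qed
  qed
  then show thesis using that by blast
qed

text \<open>A fixed vector equals its average with its image. Averaging its basis expansion writes
  it in terms of the vectors \<open>std_basis i + \<rho> (std_basis i)\<close>, which are integral
  and fixed.\<close>

lemma span_fixed_lattice:
  assumes "lattice_involution \<rho>"
  shows "span (fixed_lattice \<rho>) = {v. \<rho> v = v}"
proof -
  note rho = lattice_autD [of \<rho>]
  have aut: "\<rho> \<in> lattice_aut" and inv: "\<rho> (\<rho> v) = v" for v
    using assms by (auto simp: lattice_involution_def fun_eq_iff)
  note lin = rho(1) [OF aut]
  have "subspace {v. \<rho> v = v}"
    by (simp add: subspace_def linear_0 linear_add linear_scale lin)
  moreover have "fixed_lattice \<rho> \<subseteq> {v. \<rho> v = v}"
    by (auto simp: fixed_lattice_def)
  moreover have "v \<in> span (fixed_lattice \<rho>)" if "\<rho> v = v" for v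
  proof -
    have v: "v = (\<Sum>i\<in>UNIV. v $ i *\<^sub>R std_basis i)"
      using basis_expansion [of v] by (simp add: std_basis_def scalar_mult_eq_scaleR)
    have "v = (1/2) *\<^sub>R (v + \<rho> v)"
      using that by (simp add: scaleR_2 flip: scaleR_add_left)
    also have "v + \<rho> v = (\<Sum>i\<in>UNIV. v $ i *\<^sub>R (std_basis i + \<rho> (std_basis i)))"
      by (subst (1 2) v) (simp add: linear_sum linear_scale lin scaleR_right_distrib sum.distrib)
    finally have eq: "v = (1/2) *\<^sub>R (\<Sum>i\<in>UNIV. v $ i *\<^sub>R (std_basis i + \<rho> (std_basis i)))" .
    have "std_basis i + \<rho> (std_basis i) \<in> fixed_lattice \<rho>" for i
    proof -
      have "std_basis i \<in> k3_lattice"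
        by (simp add: std_basis_def k3_lattice_def axis_def)
      moreover from this have "\<rho> (std_basis i) \<in> k3_lattice"
        by (simp add: rho(3) [OF aut])
      ultimately show ?thesis
        by (simp add: fixed_lattice_def k3_lattice_def linear_add lin inv add.commute)
    qed
    then show ?thesis
      by (subst eq) (intro span_scale span_sum span_base)
  qed
  ultimately show ?thesis
    by (intro equalityI span_minimal subsetI) auto
qed

section \<open>Projection to the positive definite space\<close>

text \<open>Orthogonal projection to the span of the \<open>\<psi> (hyp_plus i)\<close> for
  \<open>\<psi>\<close> in \<open>lattice_aut\<close>; the divisor 2 is the square of each of these
  vectors.\<close>

definition pos_part :: "(k3 \<Rightarrow> k3) \<Rightarrow> k3 \<Rightarrow> k3" where
  "pos_part \<psi> v = (\<Sum>i\<in>UNIV. (v \<bullet>\<bullet> \<psi> (hyp_plus i) / 2) *\<^sub>R \<psi> (hyp_plus i))"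

lemma form_hyp_plus: "hyp_plus i \<bullet>\<bullet> hyp_plus j = (if i = j then 2 else 0)"
  by (simp add: hyp_plus_def form_std_basis)

lemma linear_pos_part: "linear (pos_part \<psi>)"
  by (rule linearI)
    (simp_all add: pos_part_def scaleR_sum_right add_divide_distrib scaleR_left_distrib sum.distrib)

lemma pos_part_in_span: "pos_part \<psi> v \<in> span (range (\<lambda>i. \<psi> (hyp_plus i)))"
  unfolding pos_part_def by (intro span_sum span_scale span_base) simp

context
  fixes \<psi> :: "k3 \<Rightarrow> k3"
  assumes \<psi>: "\<psi> \<in> lattice_aut"
begin

lemma pos_part_form: "pos_part \<psi> v \<bullet>\<bullet> \<psi> (hyp_plus i) = v \<bullet>\<bullet> \<psi> (hyp_plus i)"
proof -
  have "pos_part \<psi> v \<bullet>\<bullet> \<psi> (hyp_plus i) = (\<Sum>j\<in>UNIV. if j = i then v \<bullet>\<bullet> \<psi> (hyp_plus j) else 0)"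
    unfolding pos_part_def form_sum_left
    by (intro sum.cong refl) (simp add: lattice_autD(2) [OF \<psi>] form_hyp_plus)
  then show ?thesis by simp
qed

lemma form_neg_of_orthogonal_marked:
  assumes "\<And>i. v \<bullet>\<bullet> \<psi> (hyp_plus i) = 0" and "v \<noteq> 0"
  shows "v \<bullet>\<bullet> v < 0"
proof -
  note psi = lattice_autD [OF \<psi>]
  define w where "w = inv_into UNIV \<psi> v"
  have v: "v = \<psi> w"
    unfolding w_def using psi(4) by (simp add: bij_is_surj surj_f_inv_f)
  have "w \<bullet>\<bullet> w < 0"
    using assms by (intro form_neg_of_orthogonal) (auto simp: v psi(2) linear_0 [OF psi(1)])
  then show ?thesis by (simp add: v psi(2))
qed

text \<open>Pythagoras: \<open>v\<close> is the sum of its projection and a vector of the negative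
  definite complement.\<close>

lemma form_le_pos_part: "v \<bullet>\<bullet> v \<le> pos_part \<psi> v \<bullet>\<bullet> pos_part \<psi> v"
proof -
  let ?n = "v - pos_part \<psi> v"
  have n: "?n \<bullet>\<bullet> \<psi> (hyp_plus i) = 0" for i
    by (simp add: pos_part_form)
  have "pos_part \<psi> v \<bullet>\<bullet> ?n = 0"
    by (rule form_span_eq_0 [OF pos_part_in_span]) (use n form_commute in auto)
  moreover have "?n \<bullet>\<bullet> ?n \<le> 0"
    using form_neg_of_orthogonal_marked [OF n] by (cases "?n = 0") auto
  ultimately show ?thesis
    using form_commute [of v "pos_part \<psi> v"] by simp
qed

text \<open>The difference of the two sides lies in the span, which \<open>\<rho>\<close> preserves,
  and is orthogonal to it. Hence its square is 0, while a nonzero vector of the complement has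
  negative square.\<close>

lemma pos_part_commute:
  assumes \<rho>: "\<rho> \<in> lattice_aut" "\<And>v. \<rho> (\<rho> v) = v"
    and perm: "\<And>i. \<exists>j. \<rho> (\<psi> (hyp_plus i)) \<in> {\<psi> (hyp_plus j), - \<psi> (hyp_plus j)}"
  shows "pos_part \<psi> (\<rho> v) = \<rho> (pos_part \<psi> v)"
proof -
  let ?S = "span (range (\<lambda>i. \<psi> (hyp_plus i)))"
  note rho = lattice_autD [OF \<rho>(1)]
  have "\<rho> (\<psi> (hyp_plus i)) \<in> ?S" for i
    using perm [of i] by (metis insertE rangeI singletonD span_base span_neg)
  then have "\<rho> ` ?S \<subseteq> ?S"
    unfolding linear_span_image [OF rho(1), symmetric] by (intro span_minimal) auto
  then have S: "\<rho> (pos_part \<psi> v) \<in> ?S"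
    using pos_part_in_span by blast
  let ?u = "pos_part \<psi> (\<rho> v) - \<rho> (pos_part \<psi> v)"
  have orth: "?u \<bullet>\<bullet> \<psi> (hyp_plus i) = 0" for i
  proof -
    \<comment> \<open>An isometric involution is self-adjoint.\<close>
    have "\<rho> w \<bullet>\<bullet> \<psi> (hyp_plus i) = w \<bullet>\<bullet> \<rho> (\<psi> (hyp_plus i))" for w
      using rho(2) [of w "\<rho> (\<psi> (hyp_plus i))"] by (simp add: \<rho>(2))
    moreover have "pos_part \<psi> v \<bullet>\<bullet> \<rho> (\<psi> (hyp_plus i)) = v \<bullet>\<bullet> \<rho> (\<psi> (hyp_plus i))"
      using perm [of i] by (auto simp: pos_part_form)
    ultimately show ?thesis by (simp add: pos_part_form)
  qed
  have "?u \<in> ?S"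
    using S pos_part_in_span by (intro span_diff)
  then have "?u \<bullet>\<bullet> ?u = 0"
    by (rule form_span_eq_0) (use orth form_commute in auto)
  then have "?u = 0"
    using form_neg_of_orthogonal_marked [OF orth] by (cases "?u = 0") auto
  then show ?thesis by simp
qed

end

text \<open>A basis vector of a hyperbolic plane is isotropic, the other basis vectors are not, and
  the unique basis vector not orthogonal to it is its partner.\<close>

lemma signed_permutation_hyp_plus:
  assumes \<sigma>: "\<sigma> \<in> lattice_aut" and perm: "\<And>i. \<exists>j. \<sigma> (std_basis i) \<in> {std_basis j, - std_basis j}"
  shows "\<exists>j. \<sigma> (hyp_plus i) \<in> {hyp_plus j, - hyp_plus j}"
proof -
  note sigma = lattice_autD [OF \<sigma>]
  have "\<exists>s j. (s = 1 \<or> s = - 1) \<and> \<sigma> (std_basis i) = s *\<^sub>R std_basis j" for i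
    using perm [of i] by (metis insertE scaleR_one scaleR_minus_left singletonD)
  then obtain s k t l where st: "s = 1 \<or> s = - 1" "t = 1 \<or> t = - 1"
    and u: "\<sigma> (std_basis (U1 i)) = s *\<^sub>R std_basis k" "\<sigma> (std_basis (U2 i)) = t *\<^sub>R std_basis l"
    by metis
  have "s * s * of_int (gram k k) = 0" "t * t * of_int (gram l l) = 0" "s * t * of_int (gram k l) = 1"
    using sigma(2) [of "std_basis (U1 i)" "std_basis (U1 i)"]
      sigma(2) [of "std_basis (U2 i)" "std_basis (U2 i)"]
      sigma(2) [of "std_basis (U1 i)" "std_basis (U2 i)"]
    by (simp_all add: u form_std_basis mult.assoc mult.left_commute)
  then have gram: "gram k k = 0" "gram l l = 0" and "s * t * of_int (gram k l) = 1"
    using st by auto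
  \<comment> \<open>Isotropy rules out the indices \<open>V\<close>, so \<open>gram k l\<close> is 0
    or 1. As it yields 1 when multiplied by both signs, the basis vectors are partners and the signs
    agree.\<close>
  then obtain j where "k = U1 j \<and> l = U2 j \<or> k = U2 j \<and> l = U1 j" and "s = t"
    using st by (cases k; cases l) (auto split: if_splits)
  then have "\<sigma> (hyp_plus i) = s *\<^sub>R hyp_plus j"
    by (auto simp: hyp_plus_def linear_add [OF sigma(1)] u scaleR_right_distrib add.commute)
  then show ?thesis using st(1) by auto
qed

section \<open>The new triple and the signature of the fixed lattice\<close>

lemma exists_invariant_triple:
  assumes \<psi>: "\<psi> \<in> lattice_aut" and \<rho>: "\<rho> \<in> lattice_aut" "\<And>v. \<rho> (\<rho> v) = v"
    and perm: "\<And>i. \<exists>j. \<rho> (\<psi> (hyp_plus i)) \<in> {\<psi> (hyp_plus j), - \<psi> (hyp_plus j)}"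
    and X: "X \<bullet>\<bullet> X > 0" "\<rho> X = - X" and Y: "Y \<bullet>\<bullet> Y > 0" "\<rho> Y = - Y" "X \<bullet>\<bullet> Y = 0"
    and Z: "Z \<bullet>\<bullet> Z > 0" "\<rho> Z = Z"
  obtains x y z where "x \<bullet>\<bullet> x = 1" "y \<bullet>\<bullet> y = 1" "z \<bullet>\<bullet> z = 1" "x \<bullet>\<bullet> y = 0" "x \<bullet>\<bullet> z = 0" "y \<bullet>\<bullet> z = 0"
    "\<rho> x = - x" "\<rho> y = - y" "\<rho> z = z" "span {x, y, z} = span (range (\<lambda>i. \<psi> (hyp_plus i)))"
proof -
  let ?S = "span (range (\<lambda>i. \<psi> (hyp_plus i)))"
  note rho = lattice_autD [OF \<rho>(1)]
  define p where "p = pos_part \<psi>"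
  have p: "linear p" "\<And>v. p v \<in> ?S" "\<And>v. p (\<rho> v) = \<rho> (p v)" "\<And>v. v \<bullet>\<bullet> v \<le> p v \<bullet>\<bullet> p v"
    unfolding p_def using linear_pos_part pos_part_in_span pos_part_commute [OF \<psi> \<rho> perm]
      form_le_pos_part [OF \<psi>] by blast+
  \<comment> \<open>The projections of \<open>X\<close> and \<open>Y\<close> need not be orthogonal.
    \<open>t\<close> is their Gram-Schmidt coefficient, but it is applied before projecting:
    \<open>X\<close> and \<open>Y\<close> are orthogonal, so \<open>W\<close> has positive square,
    and therefore so has \<open>p W\<close>.\<close>
  define t where "t = (p Y \<bullet>\<bullet> p X) / (p X \<bullet>\<bullet> p X)"
  define W where "W = Y - t *\<^sub>R X"
  define nrm where "nrm v = (1 / sqrt (v \<bullet>\<bullet> v)) *\<^sub>R v" for v :: k3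
  have nrm: "nrm v \<bullet>\<bullet> nrm v = 1" if "v \<bullet>\<bullet> v > 0" for v
    using that by (simp add: nrm_def field_simps)
  have pX: "p X \<bullet>\<bullet> p X > 0" and pZ: "p Z \<bullet>\<bullet> p Z > 0"
    using X(1) Z(1) p(4) by (meson less_le_trans)+
  have "W \<bullet>\<bullet> W = Y \<bullet>\<bullet> Y + t * t * (X \<bullet>\<bullet> X)"
    using Y(3) form_commute [of Y X] by (simp add: W_def)
  also have "\<dots> > 0"
    using X(1) Y(1) by (intro add_pos_nonneg) simp_all
  finally have pW: "p W \<bullet>\<bullet> p W > 0"
    using p(4) by (meson less_le_trans)
  have "p W = p Y - t *\<^sub>R p X"
    by (simp add: W_def linear_diff linear_scale p(1))
  then have XW: "p X \<bullet>\<bullet> p W = 0"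
    using pX form_commute [of "p X" "p Y"] by (simp add: t_def)
  have \<rho>X: "\<rho> (p X) = - p X" and \<rho>Z: "\<rho> (p Z) = p Z" and \<rho>W: "\<rho> (p W) = - p W"
    by (simp_all add: X Y Z W_def linear_neg [OF p(1)] linear_diff [OF p(1)] linear_diff [OF rho(1)]
      linear_scale [OF p(1)] linear_scale [OF rho(1)] flip: p(3))
  \<comment> \<open>Eigenvectors of an isometry for the eigenvalues -1 and 1 are orthogonal.\<close>
  have XZ: "p X \<bullet>\<bullet> p Z = 0" and WZ: "p W \<bullet>\<bullet> p Z = 0"
    using rho(2) [of "p X" "p Z"] rho(2) [of "p W" "p Z"] by (simp_all add: \<rho>X \<rho>Z \<rho>W)
  define x y z where "x = nrm (p X)" and "y = nrm (p W)" and "z = nrm (p Z)"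
  have 1: "x \<bullet>\<bullet> x = 1" "y \<bullet>\<bullet> y = 1" "z \<bullet>\<bullet> z = 1"
    by (simp_all add: x_def y_def z_def nrm pX pW pZ)
  have 0: "x \<bullet>\<bullet> y = 0" "x \<bullet>\<bullet> z = 0" "y \<bullet>\<bullet> z = 0"
    by (simp_all add: x_def y_def z_def nrm_def XW XZ WZ)
  have \<rho>': "\<rho> x = - x" "\<rho> y = - y" "\<rho> z = z"
    by (simp_all add: x_def y_def z_def nrm_def \<rho>X \<rho>Z \<rho>W linear_scale [OF rho(1)])
  have sub: "{x, y, z} \<subseteq> ?S"
    by (auto simp: x_def y_def z_def nrm_def p(2) intro!: span_scale)
  have ne: "x \<noteq> y" "x \<noteq> z" "y \<noteq> z"
    using 0 1 by auto
  have "independent {x, y, z}"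
    by (rule independent_form_orthogonal)
      (use 0 1 form_commute [of y x] form_commute [of z x] form_commute [of z y] in auto)
  \<comment> \<open>Three independent vectors in a space with three generators span it.\<close>
  moreover have "dim ?S \<le> card {x, y, z}"
  proof -
    have "dim ?S \<le> card (range (\<lambda>i. \<psi> (hyp_plus i)))"
      unfolding dim_span by (rule dim_le_card') simp
    also have "\<dots> \<le> CARD(3)"
      by (rule card_image_le) simp
    finally show ?thesis using ne by simp
  qed
  ultimately have "?S \<subseteq> span {x, y, z}"
    using sub card_ge_dim_independent by blast
  moreover have "span {x, y, z} \<subseteq> ?S"
    using sub by (rule span_minimal) simp
  ultimately show thesis
    using that 0 1 \<rho>' by blast
qed

text \<open>The projection commutes with \<open>\<rho>\<close>, so both components of a fixed vector
  are fixed. In the positive definite space only multiples of \<open>z\<close> are fixed, since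
  \<open>x\<close> and \<open>y\<close> are negated; the other component lies in a negative definite
  space \<open>T\<close>, for which an orthogonal basis exists.\<close>

lemma hyperbolic_fixed_lattice:
  assumes \<psi>: "\<psi> \<in> lattice_aut" and inv: "lattice_involution \<rho>"
    and perm: "\<And>i. \<exists>j. \<rho> (\<psi> (hyp_plus i)) \<in> {\<psi> (hyp_plus j), - \<psi> (hyp_plus j)}"
    and z: "z \<bullet>\<bullet> z > 0" "\<rho> z = z" and xz: "x \<bullet>\<bullet> z = 0" and yz: "y \<bullet>\<bullet> z = 0"
    and xy: "\<rho> x = - x" "\<rho> y = - y"
    and span: "span {x, y, z} = span (range (\<lambda>i. \<psi> (hyp_plus i)))"
  shows "hyperbolic (fixed_lattice \<rho>)"
proof -
  let ?S = "span (range (\<lambda>i. \<psi> (hyp_plus i)))"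
  have \<rho>: "\<rho> \<in> lattice_aut" "\<And>v. \<rho> (\<rho> v) = v"
    using inv by (auto simp: lattice_involution_def fun_eq_iff)
  note rho = lattice_autD [OF \<rho>(1)]
  define T where "T = {v. \<rho> v = v \<and> (\<forall>i. v \<bullet>\<bullet> \<psi> (hyp_plus i) = 0)}"
  have "subspace T"
    by (auto simp: T_def subspace_def linear_0 [OF rho(1)] linear_add [OF rho(1)] linear_scale [OF rho(1)])
  moreover have "v \<bullet>\<bullet> v < 0" if "v \<in> T" "v \<noteq> 0" for v
    using that form_neg_of_orthogonal_marked [OF \<psi>] by (simp add: T_def)
  ultimately obtain N where N: "finite N" "N \<subseteq> T" "span N = T" "\<And>v. v \<in> N \<Longrightarrow> v \<bullet>\<bullet> v < 0"
    "\<And>v w. v \<in> N \<Longrightarrow> w \<in> N \<Longrightarrow> v \<noteq> w \<Longrightarrow> v \<bullet>\<bullet> w = 0"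
    using negative_orthogonal_basis by blast
  have z_S: "z \<in> ?S"
    unfolding span [symmetric] by (simp add: span_base)
  have zN: "z \<bullet>\<bullet> v = 0" "v \<bullet>\<bullet> z = 0" if "v \<in> N" for v
  proof -
    show "z \<bullet>\<bullet> v = 0"
      by (rule form_span_eq_0 [OF z_S]) (use that N(2) form_commute in \<open>auto simp: T_def\<close>)
    then show "v \<bullet>\<bullet> z = 0" by (simp add: form_commute)
  qed
  have orth: "\<forall>v\<in>{z} \<union> N. \<forall>w\<in>{z} \<union> N. v \<noteq> w \<longrightarrow> v \<bullet>\<bullet> w = 0"
    using zN N(5) by auto
  have fixed_S: "v \<in> span {z}" if v: "v \<in> ?S" "\<rho> v = v" for v
  proof -
    have "v \<in> span {x, y, z}"
      using v(1) span by simp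
    then obtain a b c where abc: "v = a *\<^sub>R x + b *\<^sub>R y + c *\<^sub>R z"
      unfolding span_insert by (auto simp: algebra_simps)
    have "\<rho> v = - (a *\<^sub>R x + b *\<^sub>R y) + c *\<^sub>R z"
      by (simp add: abc linear_add [OF rho(1)] linear_scale [OF rho(1)] xy z)
    with v(2) abc have "2 *\<^sub>R (a *\<^sub>R x + b *\<^sub>R y) = 0"
      by (simp add: scaleR_2 eq_neg_iff_add_eq_0 add.commute)
    then show ?thesis
      using abc by (simp add: span_base span_scale)
  qed
  have "span ({z} \<union> N) = {v. \<rho> v = v}"
  proof
    have "subspace {v. \<rho> v = v}"
      by (simp add: subspace_def linear_0 linear_add linear_scale rho(1))
    then show "span ({z} \<union> N) \<subseteq> {v. \<rho> v = v}"
      using z(2) N(2) by (intro span_minimal) (auto simp: T_def)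
    show "{v. \<rho> v = v} \<subseteq> span ({z} \<union> N)"
    proof safe
      fix v assume v: "\<rho> v = v"
      let ?p = "pos_part \<psi> v"
      have p: "\<rho> ?p = ?p"
        using pos_part_commute [OF \<psi> \<rho> perm, of v] v by simp
      then have "?p \<in> span {z}"
        using fixed_S pos_part_in_span by blast
      moreover have "v - ?p \<in> span N"
        unfolding N(3) by (simp add: T_def linear_diff [OF rho(1)] v p pos_part_form [OF \<psi>])
      ultimately have "?p + (v - ?p) \<in> span ({z} \<union> N)"
        by (intro span_add) (meson in_mono span_mono sup_ge1 sup_ge2)+
      then show "v \<in> span ({z} \<union> N)" by simp
    qed
  qed
  then have "span ({z} \<union> N) = span (fixed_lattice \<rho>)"
    using span_fixed_lattice [OF inv] by simp
  moreover have "independent ({z} \<union> N)"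
  proof (rule independent_form_orthogonal)
    show "finite ({z} \<union> N)"
      using N(1) by simp
    show "v \<bullet>\<bullet> w = 0" if "v \<in> {z} \<union> N" "w \<in> {z} \<union> N" "v \<noteq> w" for v w
      using orth that by blast
    show "v \<bullet>\<bullet> v \<noteq> 0" if "v \<in> {z} \<union> N" for v
      using that z(1) N(4) [of v] by auto
  qed
  ultimately have "has_signature (fixed_lattice \<rho>) 1 (card N)"
    unfolding has_signature_def using orth z(1) N(1,4)
    by (intro exI [of _ "{z}"] exI [of _ N]) simp
  then show ?thesis
    unfolding hyperbolic_def by blast
qed

section \<open>Undoing the marking, and assembly of the singular surface\<close>

lemma simple_involution_hyp_plus:
  assumes "\<rho> \<in> lattice_aut" and "simple_involution \<rho>"
  obtains \<psi> where "\<psi> \<in> lattice_aut"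
    "\<And>i. \<exists>j. \<rho> (\<psi> (hyp_plus i)) \<in> {\<psi> (hyp_plus j), - \<psi> (hyp_plus j)}"
proof -
  obtain \<phi> where \<phi>: "\<phi> \<in> lattice_aut"
    and perm: "\<And>i. \<exists>j. (\<phi> \<circ> \<rho> \<circ> inv_into UNIV \<phi>) (std_basis i) \<in> {std_basis j, - std_basis j}"
    using assms(2) unfolding simple_involution_def by blast
  define \<psi> where "\<psi> = inv_into UNIV \<phi>"
  have \<psi>: "\<psi> \<in> lattice_aut"
    unfolding \<psi>_def using \<phi> by (rule lattice_aut_inv)
  have \<psi>\<phi>: "\<psi> (\<phi> v) = v" for v
    unfolding \<psi>_def using lattice_autD(4) [OF \<phi>] by (simp add: bij_is_inj inv_f_f)
  have "f \<circ> g \<in> lattice_aut" if "f \<in> lattice_aut" "g \<in> lattice_aut" for f g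
    using that by (auto simp: lattice_aut_def linear_compose simp flip: image_image)
  then have "\<phi> \<circ> \<rho> \<circ> \<psi> \<in> lattice_aut"
    using assms(1) \<phi> \<psi> by blast
  then have "\<exists>j. (\<phi> \<circ> \<rho> \<circ> \<psi>) (hyp_plus i) \<in> {hyp_plus j, - hyp_plus j}" for i
    using perm unfolding \<psi>_def by (rule signed_permutation_hyp_plus)
  \<comment> \<open>Applying \<open>\<psi>\<close> cancels \<open>\<phi>\<close> and turns the
    statement about the conjugate into one about \<open>\<rho>\<close>.\<close>
  then have "\<exists>j. \<psi> (\<phi> (\<rho> (\<psi> (hyp_plus i)))) \<in> {\<psi> (hyp_plus j), - \<psi> (hyp_plus j)}" for i
    by (metis comp_apply insert_iff linear_neg [OF lattice_autD(1) [OF \<psi>]] singletonD)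
  then show thesis
    using that \<psi> by (simp add: \<psi>\<phi>)
qed

theorem theorem5p1:
  fixes r a \<delta> :: nat
  assumes "r \<ge> 1" and "\<delta> \<in> {0, 1}"
    and "\<exists>x y z \<rho>. nonsymplectic_involution x y z \<rho> \<and> simple_involution \<rho>
           \<and> has_invariants (fixed_lattice \<rho>) r a \<delta>"
  shows "\<exists>x y z \<rho>. hk_triple x y z
           \<and> has_singularities x y z
               {#A_type 1, A_type 1, A_type 1, E_type 8, E_type 8#}
           \<and> hk_nonsymplectic_involution x y z \<rho> r a \<delta>"
proof -
  obtain X Y Z \<rho> where nonsymp: "nonsymplectic_involution X Y Z \<rho>"
    and "simple_involution \<rho>" and invariants: "has_invariants (fixed_lattice \<rho>) r a \<delta>"
    using assms(3) by blast
  have inv: "lattice_involution \<rho>" and XY: "\<rho> X = - X" "\<rho> Y = - Y"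
    and hk: "hk_triple X Y Z" and cone: "\<rho> Z \<in> kaehler_cone X Y Z"
    using nonsymp by (auto simp: nonsymplectic_involution_def smooth_triple_def)
  have \<rho>: "\<rho> \<in> lattice_aut" "\<And>v. \<rho> (\<rho> v) = v"
    using inv by (auto simp: lattice_involution_def fun_eq_iff)
  obtain \<psi> where \<psi>: "\<psi> \<in> lattice_aut"
    and perm: "\<And>i. \<exists>j. \<rho> (\<psi> (hyp_plus i)) \<in> {\<psi> (hyp_plus j), - \<psi> (hyp_plus j)}"
    using simple_involution_hyp_plus [OF \<rho>(1) \<open>simple_involution \<rho>\<close>] by blast
  \<comment> \<open>\<open>Z\<close> need not be invariant, so it is symmetrised. Since
    \<open>\<rho> Z\<close> lies in the Kaehler cone, it has positive square and positive product
    with \<open>Z\<close>, so the sum has positive square.\<close>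
  have "(Z + \<rho> Z) \<bullet>\<bullet> (Z + \<rho> Z) > 0"
    using hk cone form_commute [of Z "\<rho> Z"] by (simp add: hk_triple_def kaehler_cone_def)
  moreover have "\<rho> (Z + \<rho> Z) = Z + \<rho> Z"
    by (simp add: linear_add [OF lattice_autD(1) [OF \<rho>(1)]] \<rho>(2) add.commute)
  moreover have "X \<bullet>\<bullet> X > 0" "Y \<bullet>\<bullet> Y > 0" "X \<bullet>\<bullet> Y = 0"
    using hk by (auto simp: hk_triple_def)
  ultimately obtain x y z where 1: "x \<bullet>\<bullet> x = 1" "y \<bullet>\<bullet> y = 1" "z \<bullet>\<bullet> z = 1"
    and 0: "x \<bullet>\<bullet> y = 0" "x \<bullet>\<bullet> z = 0" "y \<bullet>\<bullet> z = 0"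
    and xyz: "\<rho> x = - x" "\<rho> y = - y" "\<rho> z = z"
    and span: "span {x, y, z} = span (range (\<lambda>i. \<psi> (hyp_plus i)))"
    using exists_invariant_triple [OF \<psi> \<rho> perm] XY by metis
  have hk': "hk_triple x y z"
    by (simp add: hk_triple_def 0 1)
  \<comment> \<open>As the two triples of vectors have the same span, the singular roots are exactly
    the roots orthogonal to all \<open>\<psi> (hyp_plus i)\<close>.\<close>
  have "x \<bullet>\<bullet> d = 0 \<and> y \<bullet>\<bullet> d = 0 \<and> z \<bullet>\<bullet> d = 0 \<longleftrightarrow> (\<forall>i. d \<bullet>\<bullet> \<psi> (hyp_plus i) = 0)" for d
  proof
    assume d: "x \<bullet>\<bullet> d = 0 \<and> y \<bullet>\<bullet> d = 0 \<and> z \<bullet>\<bullet> d = 0"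
    show "\<forall>i. d \<bullet>\<bullet> \<psi> (hyp_plus i) = 0"
    proof
      fix i
      have "\<psi> (hyp_plus i) \<in> span {x, y, z}"
        unfolding span by (simp add: span_base)
      then have "\<psi> (hyp_plus i) \<bullet>\<bullet> d = 0"
        by (rule form_span_eq_0) (use d in auto)
      then show "d \<bullet>\<bullet> \<psi> (hyp_plus i) = 0"
        by (simp add: form_commute)
    qed
  next
    assume d: "\<forall>i. d \<bullet>\<bullet> \<psi> (hyp_plus i) = 0"
    have "v \<bullet>\<bullet> d = 0" if "v \<in> {x, y, z}" for v
    proof (rule form_span_eq_0)
      show "v \<in> span (range (\<lambda>i. \<psi> (hyp_plus i)))"
        unfolding span [symmetric] using that by (rule span_base)
    qed (use d form_commute in auto)
    then show "x \<bullet>\<bullet> d = 0 \<and> y \<bullet>\<bullet> d = 0 \<and> z \<bullet>\<bullet> d = 0" by blast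
  qed
  then have "has_singularities x y z {#A_type 1, A_type 1, A_type 1, E_type 8, E_type 8#}"
    by (rule has_singularities_3A1_2E8 [OF \<psi>])
  moreover have "hyperbolic (fixed_lattice \<rho>)"
    using hyperbolic_fixed_lattice [OF \<psi> inv perm _ xyz(3) 0(2,3) xyz(1,2) span] 1(3) by simp
  moreover have "two_elementary (fixed_lattice \<rho>)"
    using invariants by (auto simp: has_invariants_def two_elementary_def)
  ultimately show ?thesis
    using hk' inv xyz invariants unfolding hk_nonsymplectic_involution_def by blast
qed

end
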